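(* Let $\mathbf{Disc}$, $E_{\mathbf{Disc}}$, $Q_{\mathbf{Disc}}$ and the step maps $S_1,\dots,S_m:\mathbf{Disc}\to E_{\mathbf{Disc}}$ be as described in the context (for any choice of the data $\psi,\eta,\mathbf x_1,\dots,\mathbf x_m$ made there). Then the finite family $S_1,\dots,S_m$ has no common upper bound in $\{\varphi\in[\mathbf{Disc}\to E_{\mathbf{Disc}}]:\varphi\ll Q_{\mathbf{Disc}}\}$. Consequently, $[\mathbf{Disc}\to E_{\mathbf{Disc}}]$ is not continuous.
   Context: $[X\to Y]$ is the dcpo of Scott-continuous maps $X\to Y$ ordered pointwise; $\ll$ is the way-below relation; directed sets are nonempty. For an element $x$ of a domain, $\Downarrow x=\{y:y\ll x\}$. $\mathbf{Disc}$ is the dcpo of all closed disks in the Euclidean plane $\mathbb R^2$ (radius $r\ge 0$), together with the whole plane as least element, ordered by reverse inclusion. A non-bottom disk $\overline B(\mathbf z,r)$ is represented by $\mathbf x=(-r,\mathbf z)\in H:=(-\infty,0]\times\mathbb R^2$, and the non-bottom elements are identified with $H$. Let $C=\{(t,\mathbf z)\in\mathbb R\times\mathbb R^2: t\ge\|\mathbf z\|\}$ and write $\mathbf x\le_C\mathbf y$ when $\mathbf y-\mathbf x\in C$. Under the identification, reverse inclusion on non-bottom disks is the order $\le_C$ on $H$, and $\mathbf x\ll\mathbf y\iff\mathbf y-\mathbf x\in\operatorname{int}C$ for non-bottom elements. For a domain $X$: $\mathcal D(X)=\{\varnothing\}\cup\{A\subseteq X:A\text{ directed}\}$ and $E_X=(\mathcal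 D(X)\times\{0\})\cup(\mathcal P(X)\times\{1\})$, where $\mathcal P(X)$ is the powerset, ordered by $(A,i)\le(B,j)\iff A\subseteq B$ and $i\le j$. The map $Q_{\mathbf{Disc}}:\mathbf{Disc}\to E_{\mathbf{Disc}}$ is $Q_{\mathbf{Disc}}(x)=(\Downarrow x,0)$. For $u\ll v$ in $\mathbf{Disc}$, $S_{u,v}:\mathbf{Disc}\to E_{\mathbf{Disc}}$ is given by $S_{u,v}(x)=(\{u\},0)$ if $v\ll x$ and $S_{u,v}(x)=(\varnothing,0)$ otherwise. Data: $P=[-6,-4]\times[-1,1]^2$, $\Omega=(-6,-4)\times(-1,1)^2$; $\psi\in C_c^\infty(\Omega)$ with $\psi\ge0$ and $\int_\Omega\psi=1$; $L_\psi=\int_\Omega\|\nabla\psi(\mathbf x)\|\,d\mathbf x$ (Euclidean norm); $\eta>0$ with $\eta L_\psi<1$; $\mathbf e=(1,0,0)$. For $\mathbf x\in P$ put $\mathbf u_{\mathbf x}=\mathbf x-\frac{3\eta}{4}\mathbf e$, $\mathbf v_{\mathbf x}=\mathbf x-\frac{\eta}{2}\mathbf e$ (so $\mathbf u_{\mathbf x}\ll\mathbf v_{\mathbf x}\ll\mathbf x$), and $N_{\mathbf x}=\{\mathbf y\in H:\mathbf y-\mathbf v_{\mathbf x}\in\operatorname{int}C,\ \mathbf u_{\mathbf x}-\mathbf y+\eta\mathbf e\in\operatorname{int}C\}$, which is a Euclidean neighborhood of $\mathbf x$. By compactness of $P$, choose $\mathbf x_1,\dots,\mathbf x_m\in P$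 with $P\subseteq\bigcup_{j=1}^mN_{\mathbf x_j}$. Put $\mathbf u_j=\mathbf u_{\mathbf x_j}$, $\mathbf v_j=\mathbf v_{\mathbf x_j}$ and $S_j=S_{\mathbf u_j,\mathbf v_j}$ for $1\le j\le m$. *)

theory Defs
  imports "HOL-Analysis.Analysis" "HOL-Algebra.Order"
begin

section \<open>Directed sets, the way-below relation, continuity\<close>

text \<open>
  Posets are bundled as the records \<open>gorder\<close> of HOL-Algebra, always with \<open>eq = (=)\<close>.
  That \<open>s\<close> is the supremum of \<open>D\<close> in \<open>X\<close> is expressed by \<open>least X s (Upper X D)\<close>.
\<close>

definition poset_on :: "'a set \<Rightarrow> ('a \<Rightarrow> 'a \<Rightarrow> bool) \<Rightarrow> 'a gorder" where
  "poset_on A r = \<lparr>carrier = A, eq = (=), le = r\<rparr>"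

definition directed :: "'a gorder \<Rightarrow> 'a set \<Rightarrow> bool" where
  "directed X D \<longleftrightarrow> D \<noteq> {} \<and> D \<subseteq> carrier X \<and>
     (\<forall>a\<in>D. \<forall>b\<in>D. \<exists>c\<in>D. a \<sqsubseteq>\<^bsub>X\<^esub> c \<and> b \<sqsubseteq>\<^bsub>X\<^esub> c)"

definition way_below :: "'a gorder \<Rightarrow> 'a \<Rightarrow> 'a \<Rightarrow> bool" where
  "way_below X x y \<longleftrightarrow> x \<in> carrier X \<and> y \<in> carrier X \<and>
     (\<forall>D s. directed X D \<and> least X s (Upper X D) \<and> y \<sqsubseteq>\<^bsub>X\<^esub> s \<longrightarrow> (\<exists>d\<in>D. x \<sqsubseteq>\<^bsub>X\<^esub> d))"

definition down_wb :: "'a gorder \<Rightarrow> 'a \<Rightarrow> 'a set" where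
  "down_wb X x = {y. way_below X y x}"

text \<open>
  Existence of directed suprema is deliberately not part of the following predicate,
  so that its negation says that the approximation property itself fails.
\<close>

definition continuous_poset :: "'a gorder \<Rightarrow> bool" where
  "continuous_poset X \<longleftrightarrow>
     (\<forall>x\<in>carrier X. directed X (down_wb X x) \<and> least X x (Upper X (down_wb X x)))"

section \<open>The function space\<close>

definition scott_continuous :: "'a gorder \<Rightarrow> 'b gorder \<Rightarrow> ('a \<Rightarrow> 'b) \<Rightarrow> bool" where
  "scott_continuous X Y f \<longleftrightarrow>
     f \<in> carrier X \<rightarrow> carrier Y \<and>
     monotone_on (carrier X) (le X) (le Y) f \<and>
     (\<forall>D s. directed X D \<and> least X s (Upper X D) \<longrightarrow> least Y (f s) (Upper Y (f ` D)))"

text \<open>Maps are made extensional, so that they are determined by their values on the carrier.\<close>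

definition fun_space :: "'a gorder \<Rightarrow> 'b gorder \<Rightarrow> ('a \<Rightarrow> 'b) gorder" where
  "fun_space X Y =
     poset_on {f \<in> extensional (carrier X). scott_continuous X Y f}
              (\<lambda>f g. \<forall>x\<in>carrier X. f x \<sqsubseteq>\<^bsub>Y\<^esub> g x)"

section \<open>The domain of closed disks\<close>

type_synonym plane = "real^2"
type_synonym coord = "real \<times> (real^2)"

definition Disc :: "plane set gorder" where
  "Disc = poset_on (insert UNIV {cball z r | z r. r \<ge> 0}) (\<lambda>A B. B \<subseteq> A)"

text \<open>The half-space \<open>H\<close> and the disk represented by a point \<open>(-r, z)\<close> of it.\<close>

definition H_coord :: "coord set" where
  "H_coord = {..0} \<times> UNIV"

definition disk :: "coord \<Rightarrow> plane set" where
  "disk p = cball (snd p) (- fst p)"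

definition cone :: "coord set" where
  "cone = {(t, z). t \<ge> norm z}"

section \<open>The poset \<open>E\<^sub>X\<close> and the maps into it\<close>

definition E_poset :: "'a gorder \<Rightarrow> ('a set \<times> nat) gorder" where
  "E_poset X = poset_on
     (({{}} \<union> {A. directed X A}) \<times> {0} \<union> Pow (carrier X) \<times> {1})
     (\<lambda>(A, i) (B, j). A \<subseteq> B \<and> i \<le> j)"

definition Q_map :: "'a gorder \<Rightarrow> 'a \<Rightarrow> 'a set \<times> nat" where
  "Q_map X = (\<lambda>x\<in>carrier X. (down_wb X x, 0))"

definition step_map :: "'a gorder \<Rightarrow> 'a \<Rightarrow> 'a \<Rightarrow> 'a \<Rightarrow> 'a set \<times> nat" where
  "step_map X u v = (\<lambda>x\<in>carrier X. if way_below X v x then ({u}, 0) else ({}, 0))"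

section \<open>Test functions\<close>

primrec Ck :: "nat \<Rightarrow> ('a::euclidean_space \<Rightarrow> real) \<Rightarrow> bool" where
  "Ck 0 f \<longleftrightarrow> continuous_on UNIV f"
| "Ck (Suc k) f \<longleftrightarrow> (\<forall>x. f differentiable (at x)) \<and>
     (\<forall>v. Ck k (\<lambda>x. frechet_derivative f (at x) v))"

text \<open>Elements of \<open>C\<^sub>c\<^sup>\<infinity>(U)\<close> are extended by zero to the whole space.\<close>

definition Cc_infinity :: "'a::euclidean_space set \<Rightarrow> ('a \<Rightarrow> real) set" where
  "Cc_infinity U = {f. (\<forall>k. Ck k f) \<and>
     compact (closure {x. f x \<noteq> 0}) \<and> closure {x. f x \<noteq> 0} \<subseteq> U}"

definition gradient :: "('a::euclidean_space \<Rightarrow> real) \<Rightarrow> 'a \<Rightarrow> 'a" where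
  "gradient f x = (THE D. GDERIV f x :> D)"

section \<open>The data\<close>

definition P_box :: "coord set" where
  "P_box = {-6..-4} \<times> {z. \<forall>i. z $ i \<in> {-1..1}}"

definition Omega_box :: "coord set" where
  "Omega_box = {-6<..<-4} \<times> {z. \<forall>i. z $ i \<in> {-1<..<1}}"

definition L_grad :: "(coord \<Rightarrow> real) \<Rightarrow> real" where
  "L_grad \<psi> = (LINT x:Omega_box|lborel. norm (gradient \<psi> x))"

definition e_dir :: "coord" where
  "e_dir = (1, 0)"

definition u_pt :: "real \<Rightarrow> coord \<Rightarrow> coord" where
  "u_pt \<eta> x = x - (3 * \<eta> / 4) *\<^sub>R e_dir"

definition v_pt :: "real \<Rightarrow> coord \<Rightarrow> coord" where
  "v_pt \<eta> x = x - (\<eta> / 2) *\<^sub>R e_dir"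

definition N_nbhd :: "real \<Rightarrow> coord \<Rightarrow> coord set" where
  "N_nbhd \<eta> x = {y \<in> H_coord. y - v_pt \<eta> x \<in> interior cone \<and> u_pt \<eta> x - y + \<eta> *\<^sub>R e_dir \<in> interior cone}"

definition S_at :: "real \<Rightarrow> coord \<Rightarrow> plane set \<Rightarrow> plane set set \<times> nat" where
  "S_at \<eta> x = step_map Disc (disk (u_pt \<eta> x)) (disk (v_pt \<eta> x))"

end

theory Submission
  imports Defs
begin

text \<open>
  Let \<open>\<phi> \<lless> Q\<close>. The constant maps with value \<open>(K, 1)\<close>, \<open>K\<close> finite, form a directed family whose supremum
  is above \<open>Q\<close>, so all directed sets \<open>fst (\<phi> x)\<close> lie in one finite set and have a greatest element.
  If \<open>\<phi>\<close> dominates the step maps, these greatest elements define on \<open>\<Omega>\<close> a map \<open>g\<close> with finitely many values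
  that is monotone for the cone order and satisfies \<open>norm (x - g x) \<le> \<eta>\<close>.

  For such a \<open>g\<close> and \<open>J (t, z) = (t, - z)\<close> the integral of \<open>J (g x) \<bullet> \<nabla>\<psi> x\<close> is at most \<open>0\<close>: up to a negligible
  error, \<open>g\<close> locally takes only two values \<open>a\<close> and \<open>b\<close> with \<open>b - a\<close> in the cone, \<open>b\<close> being taken on an upper set,
  and translating an upper set in the direction \<open>J (b - a)\<close>, which is again in the cone, shrinks it. But the
  integral of \<open>J x \<bullet> \<nabla>\<psi> x\<close> is \<open>- (1 - 1 - 1) = 1\<close>, so \<open>1 \<le> \<eta> * L\<close>.
\<close>

section \<open>Order theory: the disk domain and the function space into
  \<open>E_poset\<close>\<close>

section \<open>Directed sets and the way-below relation\<close>

text \<open>The sign of the flux needs only that the linear map applied to \<open>g x\<close>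
  preserves the cone. The identity map would do for that, but then the comparison field
  \<open>x\<close> has flux \<open>-3\<close>, again negative, and nothing follows. The reflection
  keeps the cone and makes the trace \<open>1 - 1 - 1\<close> negative; with a single spatial
  coordinate the trace would be \<open>0\<close> and the comparison empty. The obstacle is that
  \<open>g\<close> may be wild where three or more of its values meet. A test function cut off at
  radius \<open>h\<close> has a gradient of order \<open>1 / h\<close>, so the bad set has to have
  measure \<open>o(h)\<close>. It does: a third value squeezed between \<open>a\<close> and
  \<open>b\<close> forces \<open>g\<close> to change both shortly below and shortly above the point
  on its vertical line. A level set meets vertical lines in intervals, and Scott continuity denies
  them a least point. A nonempty one thus has positive length, and for small \<open>h\<close> none
  of its points is close to both ends. Dominated convergence over the vertical lines then gives
  \<open>o(h)\<close>.\<close>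

lemma poset_on_simps [simp]:
  "carrier (poset_on A r) = A" "le (poset_on A r) = r" "eq (poset_on A r) = (=)"
  by (simp_all add: poset_on_def)

lemma least_Upper_iff:
  "least X s (Upper X D) \<longleftrightarrow> s \<in> carrier X \<and> (\<forall>d\<in>D \<inter> carrier X. d \<sqsubseteq>\<^bsub>X\<^esub> s) \<and>
     (\<forall>b\<in>carrier X. (\<forall>d\<in>D \<inter> carrier X. d \<sqsubseteq>\<^bsub>X\<^esub> b) \<longrightarrow> s \<sqsubseteq>\<^bsub>X\<^esub> b)"
  unfolding least_def Upper_def by blast

lemma way_below_imp_le:
  assumes "way_below X x y" and refl: "y \<sqsubseteq>\<^bsub>X\<^esub> y"
  shows "x \<sqsubseteq>\<^bsub>X\<^esub> y"
proof -
  have y: "y \<in> carrier X" using assms by (simp add: way_below_def)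
  then have "directed X {y}" "least X y (Upper X {y})"
    using refl by (auto simp: directed_def least_Upper_iff)
  then show ?thesis using assms by (auto simp: way_below_def)
qed

text \<open>Serves three purposes: merging a finite subfamily of disks, producing the greatest
  element of a finite directed set (\<open>B = A\<close>), and finding a common bound of finitely
  many approximations.\<close>

lemma directed_finite_upper_bound:
  assumes "directed X A" and trans: "\<And>a b c. a \<sqsubseteq>\<^bsub>X\<^esub> b \<Longrightarrow> b \<sqsubseteq>\<^bsub>X\<^esub> c \<Longrightarrow> a \<sqsubseteq>\<^bsub>X\<^esub> c"
    and "finite B" "B \<subseteq> A"
  obtains m where "m \<in> A" "\<And>b. b \<in> B \<Longrightarrow> b \<sqsubseteq>\<^bsub>X\<^esub> m"
proof -
  have "\<exists>m\<in>A. \<forall>b\<in>B. b \<sqsubseteq>\<^bsub>X\<^esub> m"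
    using \<open>finite B\<close> \<open>B \<subseteq> A\<close>
  proof (induction B)
    case empty
    then show ?case using assms(1) by (auto simp: directed_def)
  next
    case (insert x B)
    then obtain m where "m \<in> A" "\<forall>b\<in>B. b \<sqsubseteq>\<^bsub>X\<^esub> m" by auto
    moreover obtain n where "n \<in> A" "m \<sqsubseteq>\<^bsub>X\<^esub> n" "x \<sqsubseteq>\<^bsub>X\<^esub> n"
      using assms(1) insert.prems \<open>m \<in> A\<close> unfolding directed_def by blast
    ultimately show ?case using trans by blast
  qed
  then show ?thesis using that by blast
qed

section \<open>The domain of disks\<close>

lemma Disc_carrier: "carrier Disc = insert UNIV {cball z r | z r. r \<ge> 0}"
  by (simp add: Disc_def)

lemma Disc_le [simp]: "x \<sqsubseteq>\<^bsub>Disc\<^esub> y \<longleftrightarrow> y \<subseteq> x"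
  by (simp add: Disc_def)

lemma UNIV_in_Disc [simp]: "UNIV \<in> carrier Disc"
  by (simp add: Disc_carrier)

lemma cball_in_Disc [simp]: "r \<ge> 0 \<Longrightarrow> cball z r \<in> carrier Disc"
  by (auto simp: Disc_carrier)

text \<open>Each point \<open>p\<close> of the intersection is itself an upper bound
  \<open>cball p 0\<close>, so disks of radius zero pin the supremum to the intersection. That the
  intersection is again a disk is left to \<open>s \<in> carrier Disc\<close>.\<close>

lemma least_Upper_Disc:
  assumes "D \<subseteq> carrier Disc"
  shows "least Disc s (Upper Disc D) \<longleftrightarrow> s \<in> carrier Disc \<and> s = \<Inter> D"
proof
  assume s: "least Disc s (Upper Disc D)"
  have "p \<in> s" if "p \<in> \<Inter> D" for p
  proof -
    have "cball p 0 \<in> carrier Disc" "\<forall>d\<in>D \<inter> carrier Disc. d \<sqsubseteq>\<^bsub>Disc\<^esub> cball p 0"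
      using that cball_in_Disc[of 0 p] by auto
    then have "s \<sqsubseteq>\<^bsub>Disc\<^esub> cball p 0" using s unfolding least_Upper_iff by blast
    then show ?thesis by simp
  qed
  then show "s \<in> carrier Disc \<and> s = \<Inter> D"
    using s assms unfolding least_Upper_iff by fastforce
next
  assume "s \<in> carrier Disc \<and> s = \<Inter> D"
  then show "least Disc s (Upper Disc D)"
    using assms unfolding least_Upper_iff by auto
qed

text \<open>Unless \<open>D\<close> contains only the plane, some member is a compact disk. Its part
  outside \<open>O'\<close> is compact and already has empty intersection with finitely many
  members, which directedness merges into one.\<close>

lemma directed_Disc_Inter_subset_open:
  assumes D: "directed Disc D" and sub: "\<Inter> D \<subseteq> O'" and "open O'"
  shows "\<exists>d\<in>D. d \<subseteq> O'"
proof (cases "D \<subseteq> {UNIV}")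
  case True
  then have "D = {UNIV}" using D by (auto simp: directed_def)
  then show ?thesis using sub by auto
next
  case False
  then obtain d0 where d0: "d0 \<in> D" "d0 \<noteq> UNIV" by auto
  have Dc: "D \<subseteq> carrier Disc" using D by (simp add: directed_def)
  have cl: "closed d" if "d \<in> D" for d
    using Dc that by (auto simp: Disc_carrier)
  have "compact d0" using Dc d0 by (auto simp: Disc_carrier)
  then have cK: "compact (d0 - O')" using \<open>open O'\<close> by (simp add: compact_diff)
  have "\<exists>D'\<subseteq>D. finite D' \<and> (d0 - O') \<inter> \<Inter> D' = {}"
  proof (rule ccontr)
    assume nex: "\<not> ?thesis"
    have "(d0 - O') \<inter> \<Inter> D \<noteq> {}"
    proof (rule compact_imp_fip[OF cK])
      show "closed T" if "T \<in> D" for T using cl that .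
      show "(d0 - O') \<inter> \<Inter> F \<noteq> {}" if "finite F" "F \<subseteq> D" for F
      proof
        assume "(d0 - O') \<inter> \<Inter> F = {}"
        then show False using nex that by (meson exI)
      qed
    qed
    then show False using sub by auto
  qed
  then obtain D' where D': "D' \<subseteq> D" "finite D'" "(d0 - O') \<inter> \<Inter> D' = {}" by meson
  have "finite (insert d0 D')" "insert d0 D' \<subseteq> D" using D' d0 by auto
  then obtain m where "m \<in> D" and m: "\<And>d. d \<in> insert d0 D' \<Longrightarrow> m \<subseteq> d"
    using directed_finite_upper_bound[OF D, of "insert d0 D'"] by (metis Disc_le order_trans)
  have "m \<subseteq> d0" "m \<subseteq> \<Inter> D'" by (use m in blast)+
  then have "m \<subseteq> O'" using D'(3) by fast
  then show ?thesis using \<open>m \<in> D\<close> by blast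
qed

text \<open>The supremum lies in the interior of every member, which makes this the test family for
  \<open>way_below\<close> and, later, for lower semicontinuity of the step field.\<close>

lemma cball_shrinking:
  fixes z :: plane
  assumes "r \<ge> 0"
  defines "D \<equiv> range (\<lambda>n. cball z (r + inverse (real (Suc n))))"
  shows "directed Disc D" "\<Inter> D = cball z r"
proof -
  have mono: "cball z (r + inverse (real (Suc n))) \<subseteq> cball z (r + inverse (real (Suc m)))" if "m \<le> n" for m n
    using that by (intro subset_cball) (auto simp: field_simps)
  have "D \<subseteq> carrier Disc"
    using assms(1) unfolding D_def by (auto intro!: cball_in_Disc)
  moreover have "\<exists>c\<in>D. c \<subseteq> a \<and> c \<subseteq> b" if "a \<in> D" "b \<in> D" for a b
  proof -
    from that obtain n m where "a = cball z (r + inverse (real (Suc n)))" "b = cball z (r + inverse (real (Suc m)))"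
      unfolding D_def by blast
    then have "cball z (r + inverse (real (Suc (max m n)))) \<subseteq> a \<and> cball z (r + inverse (real (Suc (max m n)))) \<subseteq> b"
      using mono[of n "max m n"] mono[of m "max m n"] by simp
    then show ?thesis unfolding D_def by blast
  qed
  ultimately show "directed Disc D"
    by (auto simp: directed_def D_def)
  show "\<Inter> D = cball z r"
  proof
    show "cball z r \<subseteq> \<Inter> D"
      unfolding D_def by (force intro: order_trans)
    show "\<Inter> D \<subseteq> cball z r"
    proof
      fix w assume "w \<in> \<Inter> D"
      then have "dist z w \<le> r + inverse (real (Suc n))" for n unfolding D_def by auto
      then have "dist z w \<le> r"
        by (intro LIMSEQ_le_const[OF LIMSEQ_inverse_real_of_nat_add, of _ r]) auto
      then show "w \<in> cball z r" by simp
    qed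
  qed
qed

text \<open>One formula covers the bottom element too, since the plane is its own interior.
  Necessity comes from slightly larger concentric disks, sufficiency from compactness.\<close>

lemma way_below_Disc:
  "way_below Disc y x \<longleftrightarrow> x \<in> carrier Disc \<and> y \<in> carrier Disc \<and> x \<subseteq> interior y"
proof (intro iffI conjI)
  assume wb: "way_below Disc y x"
  then show x: "x \<in> carrier Disc" and y: "y \<in> carrier Disc" by (auto simp: way_below_def)
  show "x \<subseteq> interior y"
  proof (cases "x = UNIV")
    case True
    then show ?thesis using way_below_imp_le[OF wb] by (auto simp: top_unique)
  next
    case False
    then obtain z r where xr: "x = cball z r" "r \<ge> 0" using x by (auto simp: Disc_carrier)
    note D = cball_shrinking[of r z, OF xr(2)]
    have "least Disc x (Upper Disc (range (\<lambda>n. cball z (r + inverse (real (Suc n))))))"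
      using D x xr by (subst least_Upper_Disc) (auto simp: directed_def)
    then obtain n where "cball z (r + inverse (real (Suc n))) \<subseteq> y"
      using wb D(1) unfolding way_below_def by auto
    then have "ball z (r + inverse (real (Suc n))) \<subseteq> interior y"
      by (intro interior_maximal) (auto intro: order_trans[OF ball_subset_cball])
    moreover have "x \<subseteq> ball z (r + inverse (real (Suc n)))"
      unfolding xr using cball_subset_ball_iff[of z r z "r + inverse (real (Suc n))"] by simp
    ultimately show ?thesis by blast
  qed
next
  assume *: "x \<in> carrier Disc \<and> y \<in> carrier Disc \<and> x \<subseteq> interior y"
  show "way_below Disc y x"
    unfolding way_below_def
  proof (intro conjI allI impI)
    fix D s assume Ds: "directed Disc D \<and> least Disc s (Upper Disc D) \<and> x \<sqsubseteq>\<^bsub>Disc\<^esub> s"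
    then have "s = \<Inter> D" by (metis directed_def least_Upper_Disc)
    then have "\<Inter> D \<subseteq> interior y" using Ds * by auto
    then obtain d where "d \<in> D" "d \<subseteq> interior y"
      using directed_Disc_Inter_subset_open[of D "interior y"] Ds open_interior by metis
    then show "\<exists>d\<in>D. y \<sqsubseteq>\<^bsub>Disc\<^esub> d"
      using interior_subset by (metis Disc_le order_trans)
  qed (simp_all add: *)
qed

text \<open>Concentric disks slightly larger than \<open>x\<close> are way below \<open>x\<close>
  and eventually fit inside the interiors of any two given elements.\<close>

lemma directed_down_wb_Disc:
  assumes "x \<in> carrier Disc"
  shows "directed Disc (down_wb Disc x)"
proof -
  have "\<exists>w\<in>down_wb Disc x. w \<subseteq> a \<and> w \<subseteq> b"
    if ab: "a \<in> down_wb Disc x" "b \<in> down_wb Disc x" for a b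
  proof (cases "x = UNIV")
    case True
    then have "interior a = UNIV" "interior b = UNIV"
      using ab by (auto simp: down_wb_def way_below_Disc)
    then have "a = UNIV" "b = UNIV" using interior_subset by blast+
    then show ?thesis using ab by blast
  next
    case False
    then obtain z r where xr: "x = cball z r" "r \<ge> 0" using assms by (auto simp: Disc_carrier)
    note D = cball_shrinking[of r z, OF xr(2)]
    have "\<Inter> (range (\<lambda>n. cball z (r + inverse (real (Suc n))))) \<subseteq> interior a \<inter> interior b"
      unfolding D using ab by (auto simp: down_wb_def way_below_Disc xr)
    from directed_Disc_Inter_subset_open[OF D(1) this] obtain n where
      n: "cball z (r + inverse (real (Suc n))) \<subseteq> interior a \<inter> interior b" by auto
    have "cball z (r + inverse (real (Suc n))) \<in> down_wb Disc x"
      using xr cball_subset_ball_iff[of z r z "r + inverse (real (Suc n))"]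
      by (simp add: down_wb_def way_below_Disc)
    moreover have "cball z (r + inverse (real (Suc n))) \<subseteq> a \<inter> b"
      using n interior_subset by blast
    ultimately show ?thesis by blast
  qed
  moreover have "UNIV \<in> down_wb Disc x" using assms by (simp add: down_wb_def way_below_Disc)
  moreover have "down_wb Disc x \<subseteq> carrier Disc" by (auto simp: down_wb_def way_below_Disc)
  ultimately show ?thesis by (auto simp: directed_def)
qed

section \<open>The function space\<close>

lemma E_poset_le [simp]:
  "p \<sqsubseteq>\<^bsub>E_poset X\<^esub> q \<longleftrightarrow> fst p \<subseteq> fst q \<and> snd p \<le> snd q"
  by (cases p; cases q) (simp add: E_poset_def)

lemma E_poset_carrier:
  "p \<in> carrier (E_poset X) \<longleftrightarrow>
     snd p = 0 \<and> (fst p = {} \<or> directed X (fst p)) \<or> snd p = 1 \<and> fst p \<subseteq> carrier X"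
  by (cases p) (auto simp: E_poset_def)

lemma fun_space_le [simp]:
  "f \<sqsubseteq>\<^bsub>fun_space X Y\<^esub> g \<longleftrightarrow> (\<forall>x\<in>carrier X. f x \<sqsubseteq>\<^bsub>Y\<^esub> g x)"
  by (simp add: fun_space_def)

lemma fun_space_carrier:
  "f \<in> carrier (fun_space X Y) \<longleftrightarrow> f \<in> extensional (carrier X) \<and> scott_continuous X Y f"
  by (simp add: fun_space_def)

text \<open>\<open>continuous_poset\<close> says something only about elements of the carrier, so
  \<open>Q_map\<close> has to be one. Preservation of suprema is compactness again: an open set
  around the intersection already contains a member.\<close>

lemma Q_map_in_fun_space:
  "Q_map Disc \<in> carrier (fun_space Disc (E_poset Disc))"
  unfolding fun_space_carrier scott_continuous_def
proof (intro conjI allI impI)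
  show "monotone_on (carrier Disc) (le Disc) (le (E_poset Disc)) (Q_map Disc)"
    by (auto simp: monotone_on_def Q_map_def down_wb_def way_below_Disc)
next
  fix D s assume Ds: "directed Disc D \<and> least Disc s (Upper Disc D)"
  then have D: "D \<subseteq> carrier Disc" by (simp add: directed_def)
  then have s: "s \<in> carrier Disc" "s = \<Inter> D" using Ds least_Upper_Disc[OF D] by blast+
  \<comment> \<open>\<open>B\<close> is an arbitrary set, because an upper bound may lie in the
    second layer, where sets need not be directed.\<close>
  have lub: "down_wb Disc s \<subseteq> B" if B: "\<forall>d\<in>D. down_wb Disc d \<subseteq> B" for B
  proof
    fix y assume "y \<in> down_wb Disc s"
    then have y: "y \<in> carrier Disc" "\<Inter> D \<subseteq> interior y" using s by (auto simp: down_wb_def way_below_Disc)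
    then obtain d where "d \<in> D" "d \<subseteq> interior y"
      using directed_Disc_Inter_subset_open[of D "interior y"] Ds open_interior by metis
    then have "y \<in> down_wb Disc d" using y D by (auto simp: down_wb_def way_below_Disc)
    then show "y \<in> B" using B \<open>d \<in> D\<close> by blast
  qed
  have E: "Q_map Disc x \<in> carrier (E_poset Disc)" if "x \<in> carrier Disc" for x
    using that directed_down_wb_Disc by (auto simp: Q_map_def E_poset_carrier)
  have Q: "Q_map Disc x = (down_wb Disc x, 0)" if "x \<in> carrier Disc" for x
    using that by (simp add: Q_map_def)
  show "least (E_poset Disc) (Q_map Disc s) (Upper (E_poset Disc) (Q_map Disc ` D))"
    unfolding least_Upper_iff
  proof (intro conjI ballI impI)
    show "Q_map Disc s \<in> carrier (E_poset Disc)" using E s(1) .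
  next
    fix p assume "p \<in> Q_map Disc ` D \<inter> carrier (E_poset Disc)"
    then obtain d where "d \<in> D" "p = Q_map Disc d" by blast
    moreover have "down_wb Disc d \<subseteq> down_wb Disc s" if "d \<in> D" for d
      using that s by (auto simp: down_wb_def way_below_Disc)
    ultimately show "p \<sqsubseteq>\<^bsub>E_poset Disc\<^esub> Q_map Disc s"
      using Q[of d] Q[OF s(1)] subsetD[OF D \<open>d \<in> D\<close>] \<open>d \<in> D\<close> by simp
  next
    fix b assume b: "\<forall>d\<in>Q_map Disc ` D \<inter> carrier (E_poset Disc). d \<sqsubseteq>\<^bsub>E_poset Disc\<^esub> b"
    have "down_wb Disc d \<subseteq> fst b" if "d \<in> D" for d
      using b E[of d] Q[of d] D that by force
    then show "Q_map Disc s \<sqsubseteq>\<^bsub>E_poset Disc\<^esub> b"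
      using lub[of "fst b"] Q[OF s(1)] by simp
  qed
next
  show "Q_map Disc \<in> extensional (carrier Disc)" by (simp add: Q_map_def)
  show "Q_map Disc \<in> carrier Disc \<rightarrow> carrier (E_poset Disc)"
    by (rule Pi_I) (simp add: Q_map_def E_poset_carrier directed_down_wb_Disc)
qed

text \<open>The second layer of \<open>E\<^sub>X\<close> makes the constant maps with value \<open>(K, 1)\<close>, \<open>K\<close> finite,
  a directed family whose supremum dominates everything.\<close>

lemma way_below_fun_space_finite_range:
  assumes wb: "way_below (fun_space X (E_poset X)) \<phi> q"
    and q: "\<And>x. x \<in> carrier X \<Longrightarrow> fst (q x) \<subseteq> carrier X"
  obtains K where "finite K" "\<And>x. x \<in> carrier X \<Longrightarrow> fst (\<phi> x) \<subseteq> K"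
proof -
  let ?FS = "fun_space X (E_poset X)"
  let ?c = "\<lambda>K. (\<lambda>x\<in>carrier X. (K, 1)) :: 'a \<Rightarrow> 'a set \<times> nat"
  let ?D = "?c ` {K. finite K \<and> K \<subseteq> carrier X}"
  \<comment> \<open>Constant maps are Scott continuous because directed sets are nonempty: the image
    is a single point.\<close>
  have carr: "?c K \<in> carrier ?FS" if "K \<subseteq> carrier X" for K
    using that unfolding fun_space_carrier scott_continuous_def
  proof (intro conjI allI impI)
    fix D s assume "directed X D \<and> least X s (Upper X D)"
    then have "D \<subseteq> carrier X" "D \<noteq> {}" "s \<in> carrier X" by (auto simp: directed_def least_Upper_iff)
    moreover from this have "?c K ` D = {(K, 1)}" by force
    ultimately show "least (E_poset X) (?c K s) (Upper (E_poset X) (?c K ` D))"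
      using that by (auto simp: least_Upper_iff E_poset_carrier)
  qed (auto simp: monotone_on_def E_poset_carrier)
  have qc: "q \<in> carrier ?FS" using wb by (simp add: way_below_def)
  have "\<exists>c\<in>?D. a \<sqsubseteq>\<^bsub>?FS\<^esub> c \<and> b \<sqsubseteq>\<^bsub>?FS\<^esub> c" if "a \<in> ?D" "b \<in> ?D" for a b
  proof -
    obtain K L where "a = ?c K" "b = ?c L" "finite K" "finite L" "K \<subseteq> carrier X" "L \<subseteq> carrier X"
      using \<open>a \<in> ?D\<close> \<open>b \<in> ?D\<close> by blast
    then show ?thesis by (intro bexI[of _ "?c (K \<union> L)"]) auto
  qed
  then have "directed ?FS ?D" using carr by (auto simp: directed_def)
  moreover have "least ?FS (?c (carrier X)) (Upper ?FS ?D)"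
    unfolding least_Upper_iff
  proof (intro conjI ballI impI)
    fix b assume b: "\<forall>d\<in>?D \<inter> carrier ?FS. d \<sqsubseteq>\<^bsub>?FS\<^esub> b"
    \<comment> \<open>Singletons suffice: they force every \<open>y\<close> into each value of
      \<open>b\<close> and the layer of that value up to \<open>1\<close>.\<close>
    have "?c {y} \<sqsubseteq>\<^bsub>?FS\<^esub> b" if "y \<in> carrier X" for y
      using b carr[of "{y}"] that by blast
    then show "?c (carrier X) \<sqsubseteq>\<^bsub>?FS\<^esub> b"
      by (fastforce simp: subset_iff)
  qed (use carr in auto)
  \<comment> \<open>\<open>(carrier X, 1)\<close> is the greatest element of
    \<open>E_poset X\<close>.\<close>
  moreover have "q \<sqsubseteq>\<^bsub>?FS\<^esub> ?c (carrier X)"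
  proof -
    have "q x \<in> carrier (E_poset X)" if "x \<in> carrier X" for x
      using qc that unfolding fun_space_carrier scott_continuous_def by (meson PiE)
    then have "snd (q x) \<le> 1" if "x \<in> carrier X" for x
      using that unfolding E_poset_carrier by fastforce
    then show ?thesis using q by auto
  qed
  ultimately obtain d where "d \<in> ?D" "\<phi> \<sqsubseteq>\<^bsub>?FS\<^esub> d"
    using wb unfolding way_below_def by blast
  then show ?thesis using that by auto
qed

text \<open>Extracts from a supremum one member that catches \<open>u\<close> at \<open>x\<close>.
  The pointwise union of the family is a Scott-continuous upper bound, so \<open>q\<close> lies
  below it. \<open>layer\<close> keeps the whole family in the first layer, where values are empty
  or directed, and unions along a directed family stay so.\<close>

lemma directed_least_fun_space_pointwise:
  assumes F: "directed (fun_space X (E_poset X)) F"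
    and q: "least (fun_space X (E_poset X)) q (Upper (fun_space X (E_poset X)) F)"
    and layer: "\<And>x. x \<in> carrier X \<Longrightarrow> snd (q x) = 0"
    and x: "x \<in> carrier X" and u: "u \<in> fst (q x)"
  shows "\<exists>f\<in>F. u \<in> fst (f x)"
proof -
  let ?FS = "fun_space X (E_poset X)"
  define s where "s = (\<lambda>x\<in>carrier X. (\<Union>f\<in>F. fst (f x), 0::nat))"
  have FS: "f \<in> carrier ?FS" if "f \<in> F" for f using F that by (auto simp: directed_def)
  have snd0: "snd (f x) = 0" if "f \<in> F" "x \<in> carrier X" for f x
    using q layer[OF that(2)] FS that unfolding least_Upper_iff by force
  have fE: "f x \<in> carrier (E_poset X)" if "f \<in> F" "x \<in> carrier X" for f x
    using FS that unfolding fun_space_carrier scott_continuous_def by (meson PiE)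
  have fmono: "fst (f x) \<subseteq> fst (f y)" if "f \<in> F" "x \<in> carrier X" "y \<in> carrier X" "x \<sqsubseteq>\<^bsub>X\<^esub> y" for f x y
    using FS that by (auto simp: fun_space_carrier scott_continuous_def monotone_on_def)
  have sE: "s x \<in> carrier (E_poset X)" if x: "x \<in> carrier X" for x
  proof -
    have sub: "fst (f x) \<subseteq> carrier X" if "f \<in> F" for f
      using fE[OF that x] by (auto simp: E_poset_carrier directed_def)
    have "\<exists>c\<in>\<Union>f\<in>F. fst (f x). a \<sqsubseteq>\<^bsub>X\<^esub> c \<and> b \<sqsubseteq>\<^bsub>X\<^esub> c"
      if "f \<in> F" "g \<in> F" "a \<in> fst (f x)" "b \<in> fst (g x)" for f g a b
    proof -
      obtain k where k: "k \<in> F" "f \<sqsubseteq>\<^bsub>?FS\<^esub> k" "g \<sqsubseteq>\<^bsub>?FS\<^esub> k"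
        using F \<open>f \<in> F\<close> \<open>g \<in> F\<close> unfolding directed_def by blast
      then have "a \<in> fst (k x)" "b \<in> fst (k x)" using that x by auto
      moreover from this have "directed X (fst (k x))"
        using fE[OF k(1) x] snd0[OF k(1) x] by (auto simp: E_poset_carrier)
      ultimately show ?thesis using k(1) unfolding directed_def by blast
    qed
    then show ?thesis using x UN_least[OF sub, of F "\<lambda>f. f"] by (simp add: s_def E_poset_carrier directed_def) blast
  qed
  have "s \<in> carrier ?FS"
    unfolding fun_space_carrier scott_continuous_def
  proof (intro conjI allI impI)
    show "monotone_on (carrier X) (le X) (le (E_poset X)) s"
      using fmono by (fastforce simp: monotone_on_def s_def)
  next
    fix D t assume Dt: "directed X D \<and> least X t (Upper X D)"
    then have D: "D \<subseteq> carrier X" "t \<in> carrier X" and ub: "\<And>d. d \<in> D \<Longrightarrow> d \<sqsubseteq>\<^bsub>X\<^esub> t"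
      by (auto simp: directed_def least_Upper_iff)
    show "least (E_poset X) (s t) (Upper (E_poset X) (s ` D))"
      unfolding least_Upper_iff
    proof (intro conjI ballI impI)
      show "s t \<in> carrier (E_poset X)" using sE D by simp
    next
      fix p assume "p \<in> s ` D \<inter> carrier (E_poset X)"
      then obtain d where "p = s d" "d \<in> D" by auto
      then show "p \<sqsubseteq>\<^bsub>E_poset X\<^esub> s t" using fmono[of _ d t] ub[of d] D by (fastforce simp: s_def)
    next
      fix b assume b: "b \<in> carrier (E_poset X)" "\<forall>d\<in>s ` D \<inter> carrier (E_poset X). d \<sqsubseteq>\<^bsub>E_poset X\<^esub> b"
      have sb: "s d \<sqsubseteq>\<^bsub>E_poset X\<^esub> b" if "d \<in> D" for d using b(2) sE[of d] D that by blast
      have "f t \<sqsubseteq>\<^bsub>E_poset X\<^esub> b" if f: "f \<in> F" for f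
      proof -
        have "least (E_poset X) (f t) (Upper (E_poset X) (f ` D))"
          using FS[OF f] Dt by (auto simp: fun_space_carrier scott_continuous_def)
        moreover have "f d \<sqsubseteq>\<^bsub>E_poset X\<^esub> b" if "d \<in> D" for d
          using sb[OF that] snd0[OF f, of d] f D that by (auto simp: s_def subset_iff)
        ultimately show ?thesis using b(1) unfolding least_Upper_iff by blast
      qed
      then show "s t \<sqsubseteq>\<^bsub>E_poset X\<^esub> b" using D by (auto simp: s_def)
    qed
  next
    show "s \<in> extensional (carrier X)" by (simp add: s_def)
    show "s \<in> carrier X \<rightarrow> carrier (E_poset X)" using sE by blast
  qed
  moreover have "f \<sqsubseteq>\<^bsub>?FS\<^esub> s" if "f \<in> F" for f
    using snd0[OF that] that by (auto simp: s_def)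
  ultimately have "q \<sqsubseteq>\<^bsub>?FS\<^esub> s" using q unfolding least_Upper_iff by blast
  then show ?thesis using x u by (fastforce simp: s_def)
qed

text \<open>The union is tested in the second layer, whose elements are arbitrary subsets of the
  carrier, so its directedness is no issue. Applied to shrinking disks, this gives the lower
  semicontinuity of the step field.\<close>

lemma scott_continuous_fst_subset_Union:
  assumes f: "f \<in> carrier (fun_space X (E_poset X))"
    and D: "directed X D" "least X s (Upper X D)"
  shows "fst (f s) \<subseteq> (\<Union>d\<in>D. fst (f d))"
proof -
  have fE: "f x \<in> carrier (E_poset X)" if "x \<in> carrier X" for x
    using f that unfolding fun_space_carrier scott_continuous_def by (meson PiE)
  have DX: "D \<subseteq> carrier X" using D by (simp add: directed_def)
  have "least (E_poset X) (f s) (Upper (E_poset X) (f ` D))"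
    using f D unfolding fun_space_carrier scott_continuous_def by blast
  moreover have sub: "fst (f d) \<subseteq> carrier X" "snd (f d) \<le> 1" if "d \<in> D" for d
    using fE[OF subsetD[OF DX that]] by (auto simp: E_poset_carrier directed_def)
  have "(\<Union>d\<in>D. fst (f d), 1) \<in> carrier (E_poset X)"
    using sub(1) by (simp add: E_poset_carrier UN_least)
  moreover have "\<forall>p\<in>f ` D \<inter> carrier (E_poset X). p \<sqsubseteq>\<^bsub>E_poset X\<^esub> (\<Union>d\<in>D. fst (f d), 1)"
    using sub(2) by auto
  ultimately have "f s \<sqsubseteq>\<^bsub>E_poset X\<^esub> (\<Union>d\<in>D. fst (f d), 1)"
    unfolding least_Upper_iff by blast
  then show ?thesis by simp
qed

lemma fun_space_fst_mono:
  assumes "f \<in> carrier (fun_space X (E_poset X))" "x \<in> carrier X" "y \<in> carrier X" "x \<sqsubseteq>\<^bsub>X\<^esub> y"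
  shows "fst (f x) \<subseteq> fst (f y)"
  using assms unfolding fun_space_carrier scott_continuous_def monotone_on_def by simp

section \<open>Analysis: integration by parts against monotone maps with finitely many
  values\<close>

section \<open>Test functions\<close>

lemma integrable_indicator_cball:
  "integrable lborel (indicator (cball c r :: 'a::euclidean_space set) :: 'a \<Rightarrow> real)"
  by (rule integrable_real_indicator[OF _ emeasure_bounded_finite]) auto

lemma integrable_bounded_support:
  fixes f :: "'a::euclidean_space \<Rightarrow> 'b::{banach, second_countable_topology}"
  assumes "f \<in> borel_measurable borel" "\<And>x. norm (f x) \<le> B" "bounded K" "\<And>x. x \<notin> K \<Longrightarrow> f x = 0"
  shows "integrable lborel f"
proof -
  obtain R where R: "K \<subseteq> cball 0 R"
    using bounded_subset_ballD[OF \<open>bounded K\<close>] ball_subset_cball by (meson order_trans)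
  have "integrable lborel (\<lambda>x. B * indicator (cball 0 R) x :: real)"
    by (intro integrable_mult_right integrable_indicator_cball)
  then show ?thesis
  proof (rule Bochner_Integration.integrable_bound)
    show "AE x in lborel. norm (f x) \<le> norm (B * indicator (cball 0 R) x :: real)"
    proof (rule AE_I2)
      fix x
      show "norm (f x) \<le> norm (B * indicator (cball 0 R) x :: real)"
      proof (cases "x \<in> cball 0 R")
        case True
        then show ?thesis using assms(2)[of x] by simp
      next
        case False
        then have "x \<notin> K" using R by blast
        then show ?thesis using assms(4)[of x] by simp
      qed
    qed
  qed (use assms(1) in simp)
qed

lemma lborel_integral_translate:
  fixes f :: "'a::euclidean_space \<Rightarrow> 'b::{banach, second_countable_topology}"
  assumes "f \<in> borel_measurable borel"
  shows "(\<integral>x. f (x + c) \<partial>lborel) = (\<integral>x. f x \<partial>lborel)"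
proof -
  have "(\<integral>x. f x \<partial>lborel) = (\<integral>x. f x \<partial>distr lborel borel ((+) c))"
    by (simp add: lborel_distr_plus)
  also have "\<dots> = (\<integral>x. f (c + x) \<partial>lborel)"
    using assms by (intro integral_distr) auto
  finally show ?thesis by (simp add: add.commute)
qed

text \<open>A \<open>C^1\<close> function with compact support. The gradient \<open>D\<close> and a
  compact set outside which \<theta> vanishes are parameters, so that scaled bumps, products and
  coordinate multiples become instances with explicit gradients.\<close>

locale test_function =
  fixes \<theta> :: "'a::euclidean_space \<Rightarrow> real" and D :: "'a \<Rightarrow> 'a" and K :: "'a set"
  assumes deriv: "\<And>x. (\<theta> has_derivative (\<lambda>h. h \<bullet> D x)) (at x)"
    and cont: "continuous_on UNIV D"
    and K: "compact K" and supp: "\<And>x. x \<notin> K \<Longrightarrow> \<theta> x = 0"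
begin

lemma cont_\<theta>: "continuous_on UNIV \<theta>"
  using deriv by (meson continuous_at_imp_continuous_on has_derivative_continuous)

lemma measurable [measurable]: "\<theta> \<in> borel_measurable borel" "D \<in> borel_measurable borel"
  using cont cont_\<theta> by (auto intro: borel_measurable_continuous_onI)

lemma supp_gradient: "x \<notin> K \<Longrightarrow> D x = 0"
proof -
  assume "x \<notin> K"
  have "(\<theta> has_derivative (\<lambda>h. 0)) (at x)"
  proof (rule has_derivative_transform_within_open)
    show "((\<lambda>x. 0) has_derivative (\<lambda>h. 0)) (at x)" by simp
    show "open (- K)" using K by (simp add: compact_imp_closed open_Compl)
  qed (use \<open>x \<notin> K\<close> supp in auto)
  then have "(\<lambda>h. h \<bullet> D x) = (\<lambda>h. 0)" using deriv has_derivative_unique by blast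
  then show ?thesis by (metis inner_eq_zero_iff)
qed

lemma gradient_bounded: obtains M where "M > 0" "\<And>x. norm (D x) \<le> M"
proof -
  have "bounded (D ` K)"
    using K cont by (intro compact_imp_bounded compact_continuous_image) (auto intro: continuous_on_subset)
  then obtain M where "M > 0" "\<forall>y\<in>D ` K. norm y \<le> M" by (auto simp: bounded_pos)
  then have "norm (D x) \<le> M" for x by (cases "x \<in> K") (auto simp: supp_gradient)
  with \<open>M > 0\<close> that show ?thesis by blast
qed

lemma bounded_\<theta>: obtains M where "M > 0" "\<And>x. \<bar>\<theta> x\<bar> \<le> M"
proof -
  have "bounded (\<theta> ` K)"
    using K cont_\<theta> by (intro compact_imp_bounded compact_continuous_image) (auto intro: continuous_on_subset)
  then obtain M where "M > 0" "\<forall>y\<in>\<theta> ` K. norm y \<le> M" by (auto simp: bounded_pos)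
  then have "\<bar>\<theta> x\<bar> \<le> M" for x by (cases "x \<in> K") (auto simp: supp)
  with \<open>M > 0\<close> that show ?thesis by blast
qed

text \<open>Such a point is a minimum. Integrands against \<open>D\<close> therefore have to be
  estimated only where \<theta> is nonzero, which is where the later hypotheses on \<open>g\<close>
  are available.\<close>

lemma gradient_nonneg_zero:
  assumes "\<And>x. \<theta> x \<ge> 0" "\<theta> x = 0"
  shows "D x = 0"
proof -
  have "(\<lambda>h. h \<bullet> D x) = (\<lambda>h. 0)"
    using assms by (intro differential_zero_maxmin[of x UNIV \<theta>]) (auto intro: deriv)
  then show ?thesis by (metis inner_eq_zero_iff)
qed

lemma integrable_times:
  assumes [measurable]: "f \<in> borel_measurable borel" and "\<And>x. norm (f x) \<le> B"
  shows "integrable lborel (\<lambda>x. f x *\<^sub>R \<theta> x)" "integrable lborel (\<lambda>x. f x *\<^sub>R D x)"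
proof -
  have B: "B \<ge> 0" using assms(2) norm_ge_zero order_trans by blast
  obtain M where M: "\<And>x. \<bar>\<theta> x\<bar> \<le> M" using bounded_\<theta> by blast
  obtain N where N: "\<And>x. norm (D x) \<le> N" using gradient_bounded by blast
  show "integrable lborel (\<lambda>x. f x *\<^sub>R \<theta> x)"
    using K assms(2) M B supp
    by (intro integrable_bounded_support[of _ "B * M" K]) (auto simp: compact_imp_bounded abs_mult intro!: mult_mono)
  show "integrable lborel (\<lambda>x. f x *\<^sub>R D x)"
    using K assms(2) N B supp_gradient
    by (intro integrable_bounded_support[of _ "B * N" K]) (auto simp: compact_imp_bounded intro!: mult_mono)
qed

lemma set_integral_eq_integral:
  assumes "K \<subseteq> U"
  shows "(LINT x:U|lborel. \<theta> x) = (\<integral>x. \<theta> x \<partial>lborel)"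
    "(LINT x:U|lborel. norm (D x)) = (\<integral>x. norm (D x) \<partial>lborel)"
proof -
  have "indicat_real U x *\<^sub>R \<theta> x = \<theta> x" "indicat_real U x *\<^sub>R norm (D x) = norm (D x)" for x
    using assms supp[of x] supp_gradient[of x] by (cases "x \<in> U"; force)+
  then show "(LINT x:U|lborel. \<theta> x) = (\<integral>x. \<theta> x \<partial>lborel)"
    "(LINT x:U|lborel. norm (D x)) = (\<integral>x. norm (D x) \<partial>lborel)"
    by (simp_all only: set_lebesgue_integral_def)
qed

text \<open>The difference quotient is moved from \<open>\<theta>\<close> to the indicator function of \<open>U\<close>.\<close>

lemma directional_integral_limit:
  assumes [measurable]: "U \<in> sets borel" and s: "\<And>n. s n > 0" "s \<longlonglongrightarrow> 0"
  shows "(\<lambda>n. (\<integral>x. (indicator U (x - s n *\<^sub>R b) - indicator U x) * \<theta> x \<partial>lborel) / s n)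
     \<longlonglongrightarrow> (\<integral>x. indicator U x * (D x \<bullet> b) \<partial>lborel)"
proof -
  define f where "f n x = indicator U x * ((\<theta> (x + s n *\<^sub>R b) - \<theta> x) / s n)" for n x
  obtain M where M: "M > 0" "\<And>x. norm (D x) \<le> M" using gradient_bounded by blast
  obtain B where B: "\<And>x. \<bar>\<theta> x\<bar> \<le> B" using bounded_\<theta> by blast
  obtain R where R: "K \<subseteq> cball 0 R"
    using bounded_subset_ballD[OF compact_imp_bounded[OF K]] ball_subset_cball by (meson order_trans)
  obtain S where S: "\<And>n. \<bar>s n\<bar> \<le> S" using s(2) by (metis BseqE Bseq_eq_bounded convergentI convergent_imp_Bseq real_norm_def)
  have lip: "\<bar>\<theta> (x + s n *\<^sub>R b) - \<theta> x\<bar> \<le> M * norm b * s n" for x n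
  proof -
    have "norm (\<theta> (x + s n *\<^sub>R b) - \<theta> x) \<le> M * norm ((x + s n *\<^sub>R b) - x)"
    proof (rule differentiable_bound[of UNIV])
      show "(\<theta> has_derivative (\<lambda>h. h \<bullet> D x)) (at x within UNIV)" for x using deriv by simp
      show "onorm (\<lambda>h. h \<bullet> D x) \<le> M" for x
      proof (rule onorm_bound)
        show "norm (h \<bullet> D x) \<le> M * norm h" for h
          using Cauchy_Schwarz_ineq2[of h "D x"] mult_left_mono[OF M(2)[of x] norm_ge_zero[of h]]
          by (simp add: mult.commute)
      qed (use M in simp)
    qed auto
    then show ?thesis using s(1)[of n] by (simp add: mult_ac)
  qed
  have "(\<lambda>n. \<integral>x. f n x \<partial>lborel) \<longlonglongrightarrow> (\<integral>x. indicator U x * (D x \<bullet> b) \<partial>lborel)"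
  proof (rule integral_dominated_convergence)
    \<comment> \<open>The ball of radius \<open>R + S * norm b\<close> contains \<open>K\<close> and
      all its translates by \<open>- s n *\<^sub>R b\<close>.\<close>
    show "integrable lborel (\<lambda>x. M * norm b * indicator (cball (0::'a) (R + S * norm b)) x :: real)"
      by (intro integrable_mult_right integrable_indicator_cball)
    show "AE x in lborel. norm (f n x) \<le> M * norm b * indicator (cball 0 (R + S * norm b)) x" for n
    proof (rule AE_I2)
      fix x
      show "norm (f n x) \<le> M * norm b * indicator (cball 0 (R + S * norm b)) x"
      proof (cases "x \<in> cball 0 (R + S * norm b)")
        case True
        have "\<bar>(\<theta> (x + s n *\<^sub>R b) - \<theta> x) / s n\<bar> \<le> M * norm b"
          using lip[of x n] s(1)[of n] by (simp add: abs_divide divide_le_eq)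
        moreover have "M * norm b \<ge> 0" using M by simp
        ultimately show ?thesis using True by (auto simp: f_def indicator_def)
      next
        case False
        have "norm (s n *\<^sub>R b) \<le> S * norm b" using S[of n] by (simp add: mult_right_mono)
        moreover have "norm x \<le> norm (x + s n *\<^sub>R b) + norm (s n *\<^sub>R b)"
          by (metis add_diff_cancel_right' norm_triangle_ineq4)
        moreover have "0 \<le> norm (s n *\<^sub>R b)" by simp
        moreover have "norm x > R + S * norm b" using False by simp
        ultimately have "norm x > R" "norm (x + s n *\<^sub>R b) > R" by linarith+
        then have "x \<notin> K" "x + s n *\<^sub>R b \<notin> K" using R by auto
        then show ?thesis using False by (simp add: f_def supp)
      qed
    qed
    show "AE x in lborel. (\<lambda>n. f n x) \<longlonglongrightarrow> indicator U x * (D x \<bullet> b)"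
    proof (rule AE_I2)
      fix x
      have "((\<lambda>r. \<theta> (x + r *\<^sub>R b)) has_derivative (\<lambda>r. (r *\<^sub>R b) \<bullet> D x)) (at 0)"
        by (rule has_derivative_compose[where g=\<theta>]) (auto intro!: derivative_eq_intros deriv)
      moreover have "(\<lambda>r. (r *\<^sub>R b) \<bullet> D x) = (*) (D x \<bullet> b)"
        by (simp add: fun_eq_iff inner_commute)
      ultimately have "((\<lambda>r. \<theta> (x + r *\<^sub>R b)) has_real_derivative (D x \<bullet> b)) (at 0)"
        by (simp add: has_field_derivative_def)
      then have "((\<lambda>r. (\<theta> (x + r *\<^sub>R b) - \<theta> x) / r) \<longlongrightarrow> D x \<bullet> b) (at 0)"
        by (simp add: DERIV_def)
      then have "(\<lambda>n. (\<theta> (x + s n *\<^sub>R b) - \<theta> x) / s n) \<longlonglongrightarrow> D x \<bullet> b"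
        by (rule filterlim_compose) (use s(2) less_imp_neq[OF s(1), symmetric] in \<open>simp add: filterlim_at\<close>)
      then show "(\<lambda>n. f n x) \<longlonglongrightarrow> indicator U x * (D x \<bullet> b)"
        unfolding f_def by (intro tendsto_intros)
    qed
  qed (auto simp: f_def)
  moreover have "(\<integral>x. f n x \<partial>lborel) =
      (\<integral>x. (indicator U (x - s n *\<^sub>R b) - indicator U x) * \<theta> x \<partial>lborel) / s n" for n
  proof -
    have int: "integrable lborel (\<lambda>x. indicator U (x + c) * \<theta> x)" for c
      using integrable_times(1)[of "\<lambda>x. indicator U (x + c) :: real" 1] by (simp add: indicator_def)
    have int': "integrable lborel (\<lambda>x. indicator U x * \<theta> (x + c))" for c
    proof (rule integrable_bounded_support[of _ B "(\<lambda>x. x - c) ` K"])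
      show "norm (indicator U x * \<theta> (x + c)) \<le> B" for x
        using B[of "x + c"] by (auto simp: indicator_def abs_mult)
      show "bounded ((\<lambda>x. x - c) ` K)" using K compact_imp_bounded bounded_translation_minus by blast
      show "indicator U x * \<theta> (x + c) = 0" if "x \<notin> (\<lambda>x. x - c) ` K" for x
      proof -
        have "x + c \<notin> K" using that by (metis add_diff_cancel_right' imageI)
        then show ?thesis by (simp add: supp)
      qed
    qed simp
    have "(\<integral>x. f n x \<partial>lborel) = (\<integral>x. (indicator U x * \<theta> (x + s n *\<^sub>R b) - indicator U x * \<theta> x) / s n \<partial>lborel)"
      by (simp add: f_def field_simps)
    also have "\<dots> = ((\<integral>x. indicator U x * \<theta> (x + s n *\<^sub>R b) \<partial>lborel) - (\<integral>x. indicator U x * \<theta> x \<partial>lborel)) / s n"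
      using int[of 0] int' by simp
    also have "(\<integral>x. indicator U x * \<theta> (x + s n *\<^sub>R b) \<partial>lborel) = (\<integral>x. indicator U (x - s n *\<^sub>R b) * \<theta> x \<partial>lborel)"
      using lborel_integral_translate[of "\<lambda>x. indicator U (x - s n *\<^sub>R b) * \<theta> x" "s n *\<^sub>R b"] by simp
    also have "\<dots> - (\<integral>x. indicator U x * \<theta> x \<partial>lborel) =
        (\<integral>x. (indicator U (x - s n *\<^sub>R b) - indicator U x) * \<theta> x \<partial>lborel)"
      using int[of 0] int[of "- s n *\<^sub>R b"] by (simp add: left_diff_distrib)
    finally show ?thesis .
  qed
  ultimately show ?thesis by simp
qed

lemma integral_gradient_zero: "(\<integral>x. D x \<bullet> b \<partial>lborel) = 0"
proof -
  have "(\<lambda>n. 0) \<longlonglongrightarrow> (\<integral>x. indicator UNIV x * (D x \<bullet> b) \<partial>lborel)"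
    using directional_integral_limit[of UNIV "\<lambda>n. inverse (real (Suc n))" b] LIMSEQ_inverse_real_of_nat by simp
  then show ?thesis by (simp add: LIMSEQ_const_iff)
qed

text \<open>The indicator of \<open>U\<close> increases in direction \<open>b\<close>, so its
  distributional derivative in that direction is nonnegative, and integration by parts flips the
  sign. Closure under translation is asked only at points where \<theta> is nonzero, because the
  sets used later are upper sets only inside a bounded region.\<close>

lemma integral_gradient_upset_nonpos:
  assumes nonneg: "\<And>x. \<theta> x \<ge> 0" and U: "U \<in> sets borel"
    and up: "\<And>x r. \<theta> x \<noteq> 0 \<Longrightarrow> r > 0 \<Longrightarrow> x - r *\<^sub>R b \<in> U \<Longrightarrow> x \<in> U"
  shows "(\<integral>x. indicator U x * (D x \<bullet> b) \<partial>lborel) \<le> 0"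
proof (rule LIMSEQ_le_const2)
  let ?s = "\<lambda>n. inverse (real (Suc n))"
  show "(\<lambda>n. (\<integral>x. (indicator U (x - ?s n *\<^sub>R b) - indicator U x) * \<theta> x \<partial>lborel) / ?s n)
     \<longlonglongrightarrow> (\<integral>x. indicator U x * (D x \<bullet> b) \<partial>lborel)"
    using directional_integral_limit[OF U, of ?s b] LIMSEQ_inverse_real_of_nat by simp
  have "(indicator U (x - ?s n *\<^sub>R b) - indicator U x) * \<theta> x \<le> 0" for x n
  proof (cases "\<theta> x = 0 \<or> x - ?s n *\<^sub>R b \<notin> U")
    case True
    then show ?thesis using nonneg[of x] by (auto simp: indicator_def)
  next
    case False
    then have "x \<in> U" using up[of x "?s n"] by simp
    then show ?thesis using False by (simp add: indicator_def)
  qed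
  \<comment> \<open>The sign is turned because nonnegativity of an integral needs no proof of
    integrability.\<close>
  then have "0 \<le> (\<integral>x. - ((indicator U (x - ?s n *\<^sub>R b) - indicator U x) * \<theta> x) \<partial>lborel)" for n
    by (intro Bochner_Integration.integral_nonneg) simp
  then have "(\<integral>x. (indicator U (x - ?s n *\<^sub>R b) - indicator U x) * \<theta> x \<partial>lborel) \<le> 0" for n
    by (simp only: integral_minus neg_0_le_iff_le)
  then show "\<exists>N. \<forall>n\<ge>N. (\<integral>x. (indicator U (x - ?s n *\<^sub>R b) - indicator U x) * \<theta> x \<partial>lborel) / ?s n \<le> 0"
    by (intro exI allI impI divide_nonpos_pos) auto
qed

text \<open>Integration by parts: \<open>(x \<bullet> i) * \<theta> x\<close> is again a test
  function, and its derivative in direction \<open>i\<close> has integral zero.\<close>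

lemma integral_coordinate_gradient:
  assumes "i \<in> Basis"
  shows "(\<integral>x. (x \<bullet> i) * (D x \<bullet> i) \<partial>lborel) = - (\<integral>x. \<theta> x \<partial>lborel)"
proof -
  interpret c: test_function "\<lambda>x. (x \<bullet> i) * \<theta> x" "\<lambda>x. (x \<bullet> i) *\<^sub>R D x + \<theta> x *\<^sub>R i" K
  proof
    show "((\<lambda>x. (x \<bullet> i) * \<theta> x) has_derivative (\<lambda>h. h \<bullet> ((x \<bullet> i) *\<^sub>R D x + \<theta> x *\<^sub>R i))) (at x)" for x
      by (rule derivative_eq_intros deriv refl)+ (auto simp: inner_add_right algebra_simps)
    show "continuous_on UNIV (\<lambda>x. (x \<bullet> i) *\<^sub>R D x + \<theta> x *\<^sub>R i)"
      by (intro continuous_intros cont cont_\<theta>)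
  qed (auto simp: K supp)
  have "0 = (\<integral>x. (x \<bullet> i) * (D x \<bullet> i) + \<theta> x \<partial>lborel)"
    using c.integral_gradient_zero[of i] assms by (simp add: inner_add_left)
  also have "\<dots> = (\<integral>x. (x \<bullet> i) * (D x \<bullet> i) \<partial>lborel) + (\<integral>x. \<theta> x \<partial>lborel)"
  proof (rule Bochner_Integration.integral_add)
    show th: "integrable lborel \<theta>" using integrable_times(1)[of "\<lambda>x. 1" 1] by simp
    have "integrable lborel (\<lambda>x. ((x \<bullet> i) *\<^sub>R D x + \<theta> x *\<^sub>R i) \<bullet> i)"
      using c.integrable_times(2)[of "\<lambda>x. 1" 1] by (intro integrable_inner_left) simp_all
    then have "integrable lborel (\<lambda>x. ((x \<bullet> i) *\<^sub>R D x + \<theta> x *\<^sub>R i) \<bullet> i - \<theta> x)"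
      using th by (rule Bochner_Integration.integrable_diff)
    then show "integrable lborel (\<lambda>x. (x \<bullet> i) * (D x \<bullet> i))"
      using assms by (simp add: inner_add_left)
  qed
  finally show ?thesis by simp
qed

end

section \<open>Thin parts of level sets\<close>

text \<open>On each vertical line the set in question has length at most \<open>k\<close>, and it is empty as soon as
  \<open>k\<close> is small compared with the length of the fibre of \<open>W\<close>.\<close>

lemma measure_thin_part_small:
  fixes W :: "(real \<times> 'b::euclidean_space) set" and k :: "nat \<Rightarrow> real"
  assumes W[measurable]: "W \<in> sets borel" and bd: "bounded W"
    and conv: "\<And>r s t z. (r, z) \<in> W \<Longrightarrow> (t, z) \<in> W \<Longrightarrow> r \<le> s \<Longrightarrow> s \<le> t \<Longrightarrow> (s, z) \<in> W"
    and left: "\<And>t z. (t, z) \<in> W \<Longrightarrow> \<exists>s<t. (s, z) \<in> W"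
    and k: "\<And>n. k n > 0" "k \<longlonglongrightarrow> 0"
  defines "T n \<equiv> {x \<in> W. x - (k n, 0) \<notin> W \<and> x + (k n, 0) \<notin> W}"
  shows "(\<lambda>n. measure lborel (T n) / k n) \<longlonglongrightarrow> 0"
proof -
  have T[measurable]: "T n \<in> sets borel" for n
    unfolding T_def by measurable
  obtain R where R: "W \<subseteq> cball 0 R"
    using bounded_subset_ballD[OF bd] ball_subset_cball by (meson order_trans)
  define \<mu> where "\<mu> n z = emeasure lborel ((\<lambda>t. (t, z)) -` T n)" for n and z :: 'b
  have sec[measurable]: "(\<lambda>t. (t, z)) -` T n \<in> sets borel" for n z
  proof -
    have "(\<lambda>t. (t, z)) -` T n \<inter> space borel \<in> sets borel"
      by (rule measurable_sets[OF _ T]) measurable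
    then show ?thesis by simp
  qed
  have TM: "T n \<in> sets (lborel \<Otimes>\<^sub>M lborel)" for n by (simp only: lborel_prod sets_lborel T)
  have \<mu>_meas[measurable]: "\<mu> n \<in> borel_measurable lborel" for n
    unfolding \<mu>_def by (rule lborel_pair.measurable_emeasure_Pair2[OF TM])
  have emT: "emeasure lborel (T n) = (\<integral>\<^sup>+z. \<mu> n z \<partial>lborel)" for n
    using lborel_pair.emeasure_pair_measure_alt2[OF TM[of n]] by (simp add: lborel_prod \<mu>_def)
  have bound: "\<mu> n z \<le> ennreal (k n) * indicator (cball 0 R) z" for n z
  proof (cases "(\<lambda>t. (t, z)) -` T n = {}")
    case True
    then show ?thesis by (simp add: \<mu>_def)
  next
    case False
    then obtain t where t: "(t, z) \<in> T n" by auto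
    \<comment> \<open>If two points of the fibre were further than \<open>k n\<close> apart,
      vertical convexity would put \<open>r + k n\<close> into \<open>W\<close>.\<close>
    have close: "s - r \<le> k n" if "(r, z) \<in> T n" "(s, z) \<in> T n" for r s
    proof (rule ccontr)
      assume "\<not> s - r \<le> k n"
      then have "(r + k n, z) \<in> W" using conv[of r z s "r + k n"] that k(1)[of n] by (auto simp: T_def)
      then show False using that by (simp add: T_def)
    qed
    define a where "a = Inf ((\<lambda>t. (t, z)) -` T n)"
    have bb: "bdd_below ((\<lambda>t. (t, z)) -` T n)"
      by (rule bdd_belowI[of _ "t - k n"]) (use close[OF _ t] in force)
    have "(\<lambda>t. (t, z)) -` T n \<subseteq> {a..a + k n}"
    proof
      fix s assume s: "s \<in> (\<lambda>t. (t, z)) -` T n"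
      have "s - k n \<le> a" unfolding a_def
        using False s close[of _ s] by (intro cInf_greatest) force+
      moreover have "a \<le> s" unfolding a_def using s bb by (rule cInf_lower)
      ultimately show "s \<in> {a..a + k n}" by simp
    qed
    then have "\<mu> n z \<le> emeasure lborel {a..a + k n}"
      unfolding \<mu>_def by (intro emeasure_mono) auto
    also have "\<dots> = ennreal (k n)" using k(1)[of n] by simp
    finally have "\<mu> n z \<le> ennreal (k n)" .
    moreover have "norm z \<le> R"
    proof -
      have "norm (t, z) \<le> R" using t R by (auto simp: T_def)
      then show ?thesis by (metis norm_snd_le order_trans)
    qed
    ultimately show ?thesis by simp
  qed
  \<comment> \<open>Fibrewise the measure is eventually zero, not merely small against
    \<open>k n\<close>: by \<open>left\<close>, a nonempty fibre of \<open>W\<close> contains two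
    points.\<close>
  have vanish: "\<forall>\<^sub>F n in sequentially. \<mu> n z = 0" for z
  proof (cases "\<exists>t. (t, z) \<in> W")
    case False
    then have "(\<lambda>t. (t, z)) -` T n = {}" for n by (auto simp: T_def)
    then show ?thesis by (simp add: \<mu>_def)
  next
    case True
    then obtain t where t: "(t, z) \<in> W" by blast
    then obtain r where r: "r < t" "(r, z) \<in> W" using left by blast
    \<comment> \<open>Half the distance suffices: from a fibre point above the middle of
      \<open>r\<close> and \<open>t\<close> the downward step stays above \<open>r\<close>, from one
      below the middle the upward step stays below \<open>t\<close>.\<close>
    have "\<forall>\<^sub>F n in sequentially. k n < (t - r) / 2"
      using k(2) r by (intro order_tendstoD(2)) auto
    then show ?thesis
    proof (rule eventually_mono)
      fix n assume n: "k n < (t - r) / 2"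
      have "(s, z) \<notin> T n" for s
      proof
        assume s: "(s, z) \<in> T n"
        then have sW: "(s, z) \<in> W" by (simp add: T_def)
        show False
        proof (cases "s \<ge> (r + t) / 2")
          case True
          then have "(s - k n, z) \<in> W" using n k(1)[of n] by (intro conv[OF r(2) sW]) argo+
          then show False using s by (simp add: T_def)
        next
          case False
          then have "(s + k n, z) \<in> W" using n k(1)[of n] by (intro conv[OF sW t]) argo+
          then show False using s by (simp add: T_def)
        qed
      qed
      then have "(\<lambda>t. (t, z)) -` T n = {}" by auto
      then show "\<mu> n z = 0" by (simp add: \<mu>_def)
    qed
  qed
  \<comment> \<open>After division by \<open>k n\<close> the fibre measures are at most
    \<open>1\<close> by \<open>bound\<close>, so the indicator of a ball dominates them.\<close>
  have "(\<lambda>n. \<integral>\<^sup>+z. \<mu> n z * ennreal (inverse (k n)) \<partial>lborel) \<longlonglongrightarrow> (\<integral>\<^sup>+z. (0::ennreal) \<partial>(lborel :: 'b measure))"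
  proof (rule nn_integral_dominated_convergence)
    show "(\<integral>\<^sup>+z. indicator (cball 0 R) z \<partial>(lborel :: 'b measure)) < \<infinity>"
      using emeasure_bounded_finite[of "cball (0::'b) R"] by simp
    show "AE z in lborel. \<mu> n z * ennreal (inverse (k n)) \<le> indicator (cball 0 R) z" for n
    proof (rule AE_I2)
      fix z
      have "\<mu> n z * ennreal (inverse (k n)) \<le> (ennreal (k n) * indicator (cball 0 R) z) * ennreal (inverse (k n))"
        using bound by (intro mult_right_mono) auto
      also have "\<dots> = (ennreal (k n) * ennreal (inverse (k n))) * indicator (cball 0 R) z"
        by (simp only: mult_ac)
      also have "ennreal (k n) * ennreal (inverse (k n)) = ennreal (k n * inverse (k n))"
        using k(1)[of n] by (intro ennreal_mult[symmetric]) auto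
      also have "\<dots> * indicator (cball 0 R) z = indicator (cball 0 R) z"
        using k(1)[of n] by simp
      finally show "\<mu> n z * ennreal (inverse (k n)) \<le> indicator (cball 0 R) z" .
    qed
    show "AE z in lborel. (\<lambda>n. \<mu> n z * ennreal (inverse (k n))) \<longlonglongrightarrow> 0"
    proof (rule AE_I2)
      fix z
      show "(\<lambda>n. \<mu> n z * ennreal (inverse (k n))) \<longlonglongrightarrow> 0"
        by (rule tendsto_eventually) (use vanish[of z] in \<open>auto elim!: eventually_mono\<close>)
    qed
  qed (measurable, auto)
  moreover have "(\<integral>\<^sup>+z. \<mu> n z * ennreal (inverse (k n)) \<partial>lborel) = ennreal (measure lborel (T n) / k n)" for n
  proof -
    have "bounded (T n)" using bd by (rule bounded_subset) (auto simp: T_def)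
    then have "emeasure lborel (T n) < \<infinity>" by (rule emeasure_bounded_finite)
    then have "emeasure lborel (T n) = ennreal (measure lborel (T n))"
      by (intro emeasure_eq_ennreal_measure) auto
    then show ?thesis using k(1)[of n]
      by (simp add: nn_integral_multc emT[symmetric] ennreal_mult divide_inverse)
  qed
  ultimately have "(\<lambda>n. ennreal (measure lborel (T n) / k n)) \<longlonglongrightarrow> ennreal 0" by simp
  then show ?thesis
    by (rule tendsto_ennrealD) (auto intro!: always_eventually divide_nonneg_pos k(1))
qed

section \<open>The cone and its reflection\<close>

lemma cone_iff: "p \<in> cone \<longleftrightarrow> norm (snd p) \<le> fst p"
  by (cases p) (simp add: cone_def)

lemma zero_in_cone [simp]: "0 \<in> cone"
  by (simp add: cone_iff)

lemma cone_add: "p \<in> cone \<Longrightarrow> q \<in> cone \<Longrightarrow> p + q \<in> cone"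
  unfolding cone_iff using norm_triangle_ineq[of "snd p" "snd q"] by auto

lemma cone_trans: "q - p \<in> cone \<Longrightarrow> r - q \<in> cone \<Longrightarrow> r - p \<in> cone"
  using cone_add[of "q - p" "r - q"] by simp

lemma cone_scaleR: "p \<in> cone \<Longrightarrow> r \<ge> 0 \<Longrightarrow> r *\<^sub>R p \<in> cone"
  by (simp add: cone_iff mult_left_mono)

lemma cone_antisym: "q - p \<in> cone \<Longrightarrow> p - q \<in> cone \<Longrightarrow> p = q"
proof -
  assume "q - p \<in> cone" "p - q \<in> cone"
  then have *: "norm (snd q - snd p) \<le> fst q - fst p" "norm (snd p - snd q) \<le> fst p - fst q"
    by (simp_all add: cone_iff)
  then have "fst q = fst p" using norm_ge_zero[of "snd q - snd p"] norm_ge_zero[of "snd p - snd q"] by linarith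
  moreover from this have "snd q = snd p" using * by simp
  ultimately show ?thesis by (simp add: prod_eq_iff)
qed

text \<open>One \<open>h\<close> pays for the first coordinate of \<open>w\<close>, the other for
  the second. The shifts \<open>2 * h\<close> and \<open>4 * h\<close> around the cut-off pieces
  originate here.\<close>

lemma shifted_small_in_cone: "norm w \<le> h \<Longrightarrow> w + (2 * h, 0) \<in> cone"
  using norm_fst_le[of "fst w" "snd w"] norm_snd_le[of "snd w" "fst w"] by (simp add: cone_iff)

definition reflect :: "coord \<Rightarrow> coord" where
  "reflect p = (fst p, - snd p)"

lemma reflect_diff: "reflect (p - q) = reflect p - reflect q"
  by (simp add: reflect_def)

lemma norm_reflect [simp]: "norm (reflect p) = norm p"
  by (simp add: reflect_def norm_prod_def)

lemma reflect_cone: "p \<in> cone \<Longrightarrow> reflect p \<in> cone"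
  by (simp add: reflect_def cone_iff)

lemma reflect_measurable [measurable]: "reflect \<in> borel_measurable borel"
  unfolding reflect_def by (intro borel_measurable_continuous_onI continuous_intros)

section \<open>A bump function\<close>

text \<open>Squaring the positive part makes it \<open>C^1\<close>, as \<open>test_function\<close>
  asks, with explicit bounds: \<open>9 / 16 = (3 / 4)^2\<close> from below on the ball of half the
  radius, and \<open>4\<close> for the norm of the gradient.\<close>

definition bump :: "'a::euclidean_space \<Rightarrow> real" where
  "bump w = (max 0 (1 - w \<bullet> w))\<^sup>2"

definition bump_gradient :: "'a::euclidean_space \<Rightarrow> 'a" where
  "bump_gradient w = (- 4 * max 0 (1 - w \<bullet> w)) *\<^sub>R w"

lemma has_derivative_square_pos_part:
  fixes t :: real
  shows "((\<lambda>t. (max 0 t)\<^sup>2) has_real_derivative 2 * max 0 t) (at t)"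
proof (cases t "0::real" rule: linorder_cases)
  case less
  have "((\<lambda>t. 0) has_real_derivative 0) (at t)" by simp
  then have "((\<lambda>t. (max 0 t)\<^sup>2) has_real_derivative 0) (at t)"
    by (rule has_field_derivative_transform_within_open[of _ _ _ "{..<0}"]) (use less in auto)
  then show ?thesis using less by simp
next
  case greater
  have "((\<lambda>t. t\<^sup>2) has_real_derivative 2 * t) (at t)" by (auto intro!: derivative_eq_intros)
  then have "((\<lambda>t. (max 0 t)\<^sup>2) has_real_derivative 2 * t) (at t)"
    by (rule has_field_derivative_transform_within_open[of _ _ _ "{0<..}"]) (use greater in auto)
  then show ?thesis using greater by simp
next
  case equal
  have "((\<lambda>h. (max 0 h)\<^sup>2 / h) \<longlongrightarrow> 0) (at (0::real))"
  proof (rule Lim_null_comparison)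
    have "norm ((max 0 h)\<^sup>2 / h) \<le> \<bar>h\<bar>" for h :: real
      by (cases "h \<le> 0") (auto simp: power2_eq_square)
    then show "\<forall>\<^sub>F h in at (0::real). norm ((max 0 h)\<^sup>2 / h) \<le> \<bar>h\<bar>" by simp
    show "((\<lambda>h. \<bar>h\<bar>) \<longlongrightarrow> 0) (at (0::real))" by (auto intro!: tendsto_eq_intros)
  qed
  then show ?thesis using equal by (simp add: DERIV_def)
qed

lemma test_function_bump:
  fixes h :: real
  assumes "h > 0"
  shows "test_function (\<lambda>w::'a::euclidean_space. bump ((1 / h) *\<^sub>R w))
     (\<lambda>w. (1 / h) *\<^sub>R bump_gradient ((1 / h) *\<^sub>R w)) (cball 0 h)"
proof
  fix x :: 'a
  define y where "y = (1 / h) *\<^sub>R x"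
  have "((\<lambda>w. 1 - ((1 / h) *\<^sub>R w) \<bullet> ((1 / h) *\<^sub>R w)) has_derivative (\<lambda>k. - (2 / h) * (k \<bullet> y))) (at x)"
    unfolding y_def by (rule derivative_eq_intros refl)+ (auto simp: inner_commute)
  from has_derivative_compose[OF this has_derivative_square_pos_part[unfolded has_field_derivative_def]]
  show "((\<lambda>w. bump ((1 / h) *\<^sub>R w)) has_derivative
      (\<lambda>k. k \<bullet> ((1 / h) *\<^sub>R bump_gradient ((1 / h) *\<^sub>R x)))) (at x)"
    by (simp add: bump_def bump_gradient_def y_def mult_ac)
next
  show "continuous_on UNIV (\<lambda>w::'a. (1 / h) *\<^sub>R bump_gradient ((1 / h) *\<^sub>R w))"
    unfolding bump_gradient_def by (intro continuous_intros)
next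
  fix x :: 'a assume "x \<notin> cball 0 h"
  then have "norm ((1 / h) *\<^sub>R x) \<ge> 1" using assms by (simp add: field_simps)
  then have "1\<^sup>2 \<le> (norm ((1 / h) *\<^sub>R x))\<^sup>2" by (rule power_mono) simp
  then show "bump ((1 / h) *\<^sub>R x) = 0" unfolding power2_norm_eq_inner by (simp add: bump_def max_def)
qed simp

lemma bump_bounds: "0 \<le> bump w" "bump w \<le> 1"
  unfolding bump_def by (auto intro!: power_le_one)

lemma bump_ge: "norm w \<le> 1 / 2 \<Longrightarrow> 9 / 16 \<le> bump w"
proof -
  assume "norm w \<le> 1 / 2"
  then have "(norm w)\<^sup>2 \<le> (1 / 2)\<^sup>2" by (rule power_mono) simp
  then have "3 / 4 \<le> max 0 (1 - w \<bullet> w)" by (simp add: power2_norm_eq_inner power_divide)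
  then have "(3 / 4)\<^sup>2 \<le> (max 0 (1 - w \<bullet> w))\<^sup>2" by (rule power_mono) simp
  then show ?thesis by (simp add: bump_def power2_eq_square)
qed

lemma norm_bump_gradient: "norm (bump_gradient w) \<le> 4"
proof (cases "norm w \<le> 1")
  case True
  have "max 0 (1 - w \<bullet> w) * norm w \<le> 1 * 1" using True by (intro mult_mono) auto
  then show ?thesis by (simp add: bump_gradient_def abs_mult)
next
  case False
  then have "1\<^sup>2 \<le> (norm w)\<^sup>2" by (intro power_mono) auto
  then show ?thesis unfolding power2_norm_eq_inner by (simp add: bump_gradient_def)
qed

text \<open>The second factor is a bump centred at \<open>- y\<close>; with \<open>x + y\<close> as
  its argument, integration over \<open>y\<close> is a plain translation.\<close>

lemma test_function_product:
  assumes "test_function \<psi> D K" "test_function \<beta> D' L"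
  shows "test_function (\<lambda>x. \<psi> x * \<beta> (x + y)) (\<lambda>x. \<beta> (x + y) *\<^sub>R D x + \<psi> x *\<^sub>R D' (x + y)) K"
proof -
  interpret \<psi>: test_function \<psi> D K by fact
  interpret \<beta>: test_function \<beta> D' L by fact
  show ?thesis
  proof
    fix x
    have "((\<lambda>x. \<beta> (x + y)) has_derivative (\<lambda>h. h \<bullet> D' (x + y))) (at x)"
      by (rule has_derivative_compose[OF _ \<beta>.deriv, of "\<lambda>x. x + y"]) (auto intro!: derivative_eq_intros)
    from has_derivative_mult[OF \<psi>.deriv this]
    show "((\<lambda>x. \<psi> x * \<beta> (x + y)) has_derivative
        (\<lambda>h. h \<bullet> (\<beta> (x + y) *\<^sub>R D x + \<psi> x *\<^sub>R D' (x + y)))) (at x)"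
      by (simp add: inner_add_right algebra_simps)
  next
    show "continuous_on UNIV (\<lambda>x. \<beta> (x + y) *\<^sub>R D x + \<psi> x *\<^sub>R D' (x + y))"
      by (intro continuous_intros \<psi>.cont \<psi>.cont_\<theta> continuous_on_compose2[OF \<beta>.cont]
          continuous_on_compose2[OF \<beta>.cont_\<theta>]) auto
  qed (auto simp: \<psi>.K \<psi>.supp)
qed

lemma lborel_integral_swap:
  fixes f :: "'a::euclidean_space \<Rightarrow> 'b::euclidean_space \<Rightarrow> real"
  assumes "(\<lambda>(x, y). f x y) \<in> borel_measurable borel" "\<And>x y. \<bar>f x y\<bar> \<le> B"
    and "bounded K" "bounded L" "\<And>x y. x \<notin> K \<or> y \<notin> L \<Longrightarrow> f x y = 0"
  shows "(\<integral>y. \<integral>x. f x y \<partial>lborel \<partial>lborel) = (\<integral>x. \<integral>y. f x y \<partial>lborel \<partial>lborel)"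
    "integrable lborel (\<lambda>x. \<integral>y. f x y \<partial>lborel)" "integrable lborel (\<lambda>y. \<integral>x. f x y \<partial>lborel)"
proof -
  have "integrable lborel (\<lambda>(x, y). f x y)"
    using assms by (intro integrable_bounded_support[of _ B "K \<times> L"] bounded_Times) auto
  then have int: "integrable (lborel \<Otimes>\<^sub>M lborel) (\<lambda>(x, y). f x y)" by (simp only: lborel_prod)
  show "(\<integral>y. \<integral>x. f x y \<partial>lborel \<partial>lborel) = (\<integral>x. \<integral>y. f x y \<partial>lborel \<partial>lborel)"
    using lborel_pair.Fubini_integral[OF int] .
  show "integrable lborel (\<lambda>x. \<integral>y. f x y \<partial>lborel)" using lborel_pair.integrable_fst[OF int] .
  show "integrable lborel (\<lambda>y. \<integral>x. f x y \<partial>lborel)" using lborel_pair.integrable_snd[OF int] .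
qed

section \<open>Monotone maps with finitely many values\<close>

text \<open>Where \<theta> is nonzero and outside \<open>B\<close>, \<open>g\<close> is
  \<open>a\<close> plus \<open>b - a\<close> times the indicator of an upper set. The constant part
  has flux zero, the indicator part has flux at most zero since \<open>reflect (b - a)\<close> is in
  the cone, and on \<open>B\<close> the deviation from \<open>a\<close> is paid for by
  \<open>M\<close>.\<close>

lemma gradient_flux_two_values:
  fixes g :: "coord \<Rightarrow> coord"
  assumes "test_function \<theta> D K" and nonneg: "\<And>x. \<theta> x \<ge> 0"
    and sub: "\<And>x. \<theta> x \<noteq> 0 \<Longrightarrow> x \<in> \<Omega>"
    and mono: "\<And>x y. x \<in> \<Omega> \<Longrightarrow> y \<in> \<Omega> \<Longrightarrow> y - x \<in> cone \<Longrightarrow> g y - g x \<in> cone"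
    and meas: "{x \<in> \<Omega>. g x - b \<in> cone} \<in> sets borel" "B \<in> sets borel" "g \<in> borel_measurable borel"
    and ab: "b - a \<in> cone" "\<And>x. \<theta> x \<noteq> 0 \<Longrightarrow> b - g x \<in> cone"
    and off: "\<And>x. \<theta> x \<noteq> 0 \<Longrightarrow> x \<notin> B \<Longrightarrow> g x = a \<or> g x = b"
    and M: "\<And>x. norm (g x - a) \<le> M"
  shows "(\<integral>x. reflect (g x) \<bullet> D x \<partial>lborel) \<le> M * (\<integral>x. indicator B x * norm (D x) \<partial>lborel)"
proof -
  interpret test_function \<theta> D K by fact
  define U where "U = {x \<in> \<Omega>. g x - b \<in> cone}"
  note [measurable] = meas(2,3) meas(1)[folded U_def]
  \<comment> \<open>A pointwise majorant of the integrand, split into these three parts; the letter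
    does not refer to the reflection.\<close>
  define J where "J x = D x \<bullet> reflect a + indicator U x * (D x \<bullet> reflect (b - a)) + M * (indicator B x * norm (D x))" for x
  have Mn: "M \<ge> 0" using M norm_ge_zero order_trans by blast
  have le: "reflect (g x) \<bullet> D x \<le> J x" for x
  proof (cases "\<theta> x = 0")
    case True
    then show ?thesis using gradient_nonneg_zero[of x] nonneg by (simp add: J_def)
  next
    case False
    have err: "0 \<le> M * (indicator B x * norm (D x))" using Mn by simp
    consider "g x = b" | "g x = a" "a \<noteq> b" | "g x \<noteq> a" "g x \<noteq> b" "x \<in> B" using off[OF False] by blast
    then show ?thesis
    proof cases
      case 1
      then have "x \<in> U" using sub[OF False] by (simp add: U_def)
      then show ?thesis using 1 err by (simp add: J_def reflect_diff inner_diff_right inner_commute)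
    next
      case 2
      then have "x \<notin> U" using cone_antisym[of b "g x"] ab(1) by (auto simp: U_def)
      then show ?thesis using 2 err by (simp add: J_def inner_commute)
    next
      case 3
      \<comment> \<open>A third value lies below \<open>b\<close> and differs from it, so the point
        is outside \<open>U\<close> and the error term alone absorbs the deviation from
        \<open>a\<close>.\<close>
      then have "x \<notin> U" using cone_antisym[of b "g x"] ab(2)[OF False] by (auto simp: U_def)
      have "reflect (g x) \<bullet> D x - D x \<bullet> reflect a = reflect (g x - a) \<bullet> D x"
        by (simp add: reflect_diff inner_diff_left inner_diff_right inner_commute)
      also have "\<dots> \<le> norm (g x - a) * norm (D x)"
        using norm_cauchy_schwarz[of "reflect (g x - a)" "D x"] by simp
      also have "\<dots> \<le> M * norm (D x)" using M by (intro mult_right_mono) auto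
      finally show ?thesis using \<open>x \<notin> U\<close> 3 by (simp add: J_def)
    qed
  qed
  have int: "integrable lborel (\<lambda>x. reflect (g x) \<bullet> D x)"
  proof -
    obtain N where N: "\<And>x. norm (D x) \<le> N" using gradient_bounded by blast
    have "norm (g x) \<le> M + norm a" for x using M[of x] norm_triangle_sub[of "g x" a] by linarith
    then have le: "norm (g x) * norm (D x) \<le> (M + norm a) * N" for x
      using N Mn by (intro mult_mono) auto
    have "norm (reflect (g x) \<bullet> D x) \<le> (M + norm a) * N" for x
      using order_trans[OF Cauchy_Schwarz_ineq2[of "reflect (g x)" "D x"]] le[of x] by simp
    then show ?thesis
      using compact_imp_bounded[OF K] supp_gradient
      by (intro integrable_bounded_support[of _ "(M + norm a) * N" K]) simp_all
  qed
  have i1: "integrable lborel (\<lambda>x. D x \<bullet> reflect a)"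
    using integrable_times(2)[of "\<lambda>x. 1" 1] by (intro integrable_inner_left) simp_all
  have i2: "integrable lborel (\<lambda>x. indicator U x * (D x \<bullet> reflect (b - a)))"
  proof -
    have "integrable lborel (\<lambda>x. (indicator U x *\<^sub>R D x) \<bullet> reflect (b - a))"
      by (intro integrable_inner_left integrable_times(2)[of _ 1]) (auto simp: indicator_def)
    then show ?thesis by simp
  qed
  have i3: "integrable lborel (\<lambda>x. indicator B x * norm (D x))"
  proof -
    have "integrable lborel (\<lambda>x. norm (indicat_real B x *\<^sub>R D x))"
      by (intro integrable_norm integrable_times(2)[of _ 1]) (auto simp: indicator_def)
    then show ?thesis by simp
  qed
  have "(\<integral>x. reflect (g x) \<bullet> D x \<partial>lborel) \<le> (\<integral>x. J x \<partial>lborel)"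
  proof (rule integral_mono[OF int _ le])
    show "integrable lborel J" unfolding J_def using i1 i2 i3 by simp
  qed
  also have "\<dots> = (\<integral>x. D x \<bullet> reflect a \<partial>lborel) + (\<integral>x. indicator U x * (D x \<bullet> reflect (b - a)) \<partial>lborel)
      + M * (\<integral>x. indicator B x * norm (D x) \<partial>lborel)"
    unfolding J_def
    by (subst Bochner_Integration.integral_add, intro Bochner_Integration.integrable_add i1 i2, simp add: i3)
      (simp add: i1 i2)
  also have "\<dots> \<le> M * (\<integral>x. indicator B x * norm (D x) \<partial>lborel)"
  proof -
    have "(\<integral>x. indicator U x * (D x \<bullet> reflect (b - a)) \<partial>lborel) \<le> 0"
    proof (rule integral_gradient_upset_nonpos[OF nonneg])
      fix x r assume x: "\<theta> x \<noteq> 0" "r > (0::real)" "x - r *\<^sub>R reflect (b - a) \<in> U"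
      let ?y = "x - r *\<^sub>R reflect (b - a)"
      \<comment> \<open>The displacement is a multiple of \<open>reflect (b - a)\<close>: this is
        where the reflection has to preserve the cone.\<close>
      have "x - ?y \<in> cone" using cone_scaleR[OF reflect_cone[OF ab(1)], of r] x by simp
      then have "g x - g ?y \<in> cone" using mono sub[OF x(1)] x(3) by (auto simp: U_def)
      then show "x \<in> U" using cone_trans[of "g ?y" b "g x"] x sub by (auto simp: U_def)
    qed simp
    then show ?thesis using integral_gradient_zero[of "reflect a"] by simp
  qed
  finally show ?thesis .
qed

text \<open>What remains of an approximation once its values are reduced to their greatest elements:
  \<open>lsc\<close> is the trace of Scott continuity, \<open>fin\<close> that of being way below.
  The value \<open>0\<close> outside \<Omega> is a convention that makes \<open>g\<close> a bounded
  Borel function on the whole space.\<close>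

locale step_field =
  fixes \<Omega> :: "coord set" and g :: "coord \<Rightarrow> coord"
  assumes open_\<Omega>: "open \<Omega>" and bounded_\<Omega>: "bounded \<Omega>" and convex_\<Omega>: "convex \<Omega>"
    and fin: "finite (g ` \<Omega>)"
    and mono: "\<And>x y. x \<in> \<Omega> \<Longrightarrow> y \<in> \<Omega> \<Longrightarrow> y - x \<in> cone \<Longrightarrow> g y - g x \<in> cone"
    and lsc: "\<And>x. x \<in> \<Omega> \<Longrightarrow> \<forall>\<^sub>F y in nhds x. g y - g x \<in> cone"
    and outside: "\<And>x. x \<notin> \<Omega> \<Longrightarrow> g x = 0"
begin

lemma open_superlevel: "open {x \<in> \<Omega>. g x - c \<in> cone}"
proof (subst open_subopen, safe)
  fix x assume x: "x \<in> \<Omega>" "g x - c \<in> cone"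
  obtain S where S: "open S" "x \<in> S" "\<And>y. y \<in> S \<Longrightarrow> g y - g x \<in> cone"
    using lsc[OF x(1)] unfolding eventually_nhds by blast
  then have "S \<inter> \<Omega> \<subseteq> {x \<in> \<Omega>. g x - c \<in> cone}" using cone_trans[OF x(2)] by blast
  then show "\<exists>T. open T \<and> x \<in> T \<and> T \<subseteq> {x \<in> \<Omega>. g x - c \<in> cone}"
    using S x open_\<Omega> by (intro exI[of _ "S \<inter> \<Omega>"]) auto
qed

text \<open>The values are only partially ordered but finite in number, so a level set is an open
  superlevel set minus the finitely many open ones belonging to strictly larger values.\<close>

lemma level_measurable: "{x \<in> \<Omega>. g x = c} \<in> sets borel"
proof -
  have "{x \<in> \<Omega>. g x = c} = {x \<in> \<Omega>. g x - c \<in> cone} -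
      (\<Union>d\<in>{d \<in> g ` \<Omega>. d \<noteq> c \<and> d - c \<in> cone}. {x \<in> \<Omega>. g x - d \<in> cone})"
    (is "?L = ?R")
  proof
    show "?L \<subseteq> ?R"
    proof
      fix x assume x: "x \<in> ?L"
      then have "d = c" if "d - c \<in> cone" "g x - d \<in> cone" for d
        using that cone_antisym[of d c] by simp
      then have "x \<notin> (\<Union>d\<in>{d \<in> g ` \<Omega>. d \<noteq> c \<and> d - c \<in> cone}. {x \<in> \<Omega>. g x - d \<in> cone})"
        by blast
      then show "x \<in> ?R" using x by simp
    qed
    show "?R \<subseteq> ?L"
    proof
      fix x assume x: "x \<in> ?R"
      then have "g x = c" by (auto dest: spec[of _ "g x"])
      then show "x \<in> ?L" using x by simp
    qed
  qed
  moreover have "finite {d \<in> g ` \<Omega>. d \<noteq> c \<and> d - c \<in> cone}" using fin by simp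
  then have "(\<Union>d\<in>{d \<in> g ` \<Omega>. d \<noteq> c \<and> d - c \<in> cone}. {x \<in> \<Omega>. g x - d \<in> cone}) \<in> sets borel"
    by (intro sets.finite_UN borel_open open_superlevel)
  ultimately show ?thesis
    using sets.Diff[OF borel_open[OF open_superlevel[of c]]] by simp
qed

lemma finite_range: "finite (range g)"
proof (rule finite_subset)
  show "range g \<subseteq> insert 0 (g ` \<Omega>)" using outside by blast
qed (use fin in simp)

lemma measurable_g [measurable]: "g \<in> borel_measurable borel"
proof (rule borel_measurable_simple_function, unfold simple_function_def, intro conjI ballI)
  show "finite (g ` space borel)" using finite_range by simp
  fix c
  have "y \<in> g -` {c} \<longleftrightarrow> y \<in> {x \<in> \<Omega>. g x = c} \<union> (if c = 0 then - \<Omega> else {})" for y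
    using outside[of y] by (cases "y \<in> \<Omega>") auto
  then have "g -` {c} = {x \<in> \<Omega>. g x = c} \<union> (if c = 0 then - \<Omega> else {})"
    by blast
  moreover have "- \<Omega> \<in> sets borel" using open_\<Omega> by auto
  ultimately have "g -` {c} \<in> sets borel"
    using level_measurable[of c] by (cases "c = 0") (simp_all add: sets.Un)
  then show "g -` {c} \<inter> space borel \<in> sets borel" by simp
qed

lemma bounded_g: obtains M where "M > 0" "\<And>x. norm (g x) \<le> M"
proof -
  have "bounded (range g)" using finite_range by (rule finite_imp_bounded)
  then show ?thesis using that by (auto simp: bounded_pos)
qed

text \<open>A change on one side only is not counted: it happens along an ordinary interface of two
  values, where the measure is in general just of order \<open>k\<close>.\<close>

definition jumps :: "real \<Rightarrow> coord set" where
  "jumps k = {x \<in> \<Omega>. x - (k, 0) \<in> \<Omega> \<and> x + (k, 0) \<in> \<Omega> \<and> g (x - (k, 0)) \<noteq> g x \<and> g (x + (k, 0)) \<noteq> g x}"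

lemma jumps_measurable [measurable]: "jumps k \<in> sets borel"
proof -
  have [measurable]: "\<Omega> \<in> sets borel" using open_\<Omega> by simp
  show ?thesis unfolding jumps_def by measurable
qed

text \<open>Every level set satisfies the hypotheses of \<open>measure_thin_part_small\<close>:
  monotonicity and convexity of \<Omega> make its vertical fibres convex, and openness of superlevel
  sets lets each fibre point move down a little.\<close>

lemma jumps_small:
  assumes k: "\<And>n. k n > 0" "k \<longlonglongrightarrow> 0"
  shows "(\<lambda>n. measure lborel (jumps (k n)) / k n) \<longlonglongrightarrow> 0"
proof -
  define W where "W c = {x \<in> \<Omega>. g x = c}" for c
  define T where "T c n = {x \<in> W c. x - (k n, 0) \<notin> W c \<and> x + (k n, 0) \<notin> W c}" for c n
  have W[measurable]: "W c \<in> sets borel" for c unfolding W_def by (rule level_measurable)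
  have Tm[measurable]: "T c n \<in> sets borel" for c n unfolding T_def by measurable
  have bdW: "bounded (W c)" for c using bounded_\<Omega> by (rule bounded_subset) (auto simp: W_def)
  have "(\<lambda>n. measure lborel (T c n) / k n) \<longlonglongrightarrow> 0" for c
    unfolding T_def
  proof (rule measure_thin_part_small[OF W bdW _ _ k])
    fix r s t z assume *: "(r, z) \<in> W c" "(t, z) \<in> W c" "r \<le> s" "s \<le> (t :: real)"
    have "(s, z) \<in> \<Omega>"
    proof -
      \<comment> \<open>For \<open>r = t\<close> the quotient is \<open>0\<close> by convention;
        then \<open>s = r\<close> and the combination is still correct.\<close>
      define u where "u = (s - r) / (t - r)"
      have "u * (t - r) = s - r" using * by (cases "r = t") (auto simp: u_def)
      then have u: "(1 - u) * r + u * t = s" by (simp add: algebra_simps)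
      have u01: "0 \<le> u" "u \<le> 1" using * by (auto simp: u_def divide_le_eq_1)
      have "(1 - u) *\<^sub>R (r, z) + u *\<^sub>R (t, z) = (s, z)"
        using u by (simp flip: scaleR_add_left)
      then show ?thesis
        using convexD_alt[OF convex_\<Omega>, of "(r, z)" "(t, z)" u] * u01 by (simp add: W_def)
    qed
    moreover have "(s, z) - (r, z) \<in> cone" "(t, z) - (s, z) \<in> cone"
      using * by (simp_all add: cone_iff)
    ultimately show "(s, z) \<in> W c"
      using * cone_antisym[of "g (s, z)" c] mono[of "(r, z)" "(s, z)"] mono[of "(s, z)" "(t, z)"]
      by (simp add: W_def)
  next
    fix t z assume t: "(t, z) \<in> W c"
    \<comment> \<open>Slightly below \<open>(t, z)\<close> the value is at least \<open>c\<close> by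
      openness and at most \<open>c\<close> by monotonicity.\<close>
    have "((\<lambda>s. (s, z)) \<longlongrightarrow> (t, z)) (at_left t)" by (intro tendsto_intros)
    moreover have "\<forall>\<^sub>F y in nhds (t, z). y \<in> {x \<in> \<Omega>. g x - c \<in> cone}"
      using t by (intro eventually_nhds_in_open open_superlevel) (auto simp: W_def)
    ultimately have "\<forall>\<^sub>F s in at_left t. (s, z) \<in> {x \<in> \<Omega>. g x - c \<in> cone}"
      unfolding filterlim_iff by blast
    then have "\<forall>\<^sub>F s in at_left t. s < t \<and> (s, z) \<in> {x \<in> \<Omega>. g x - c \<in> cone}"
      by (auto simp: eventually_at_filter elim: eventually_mono)
    then obtain s where s: "s < t" "(s, z) \<in> \<Omega>" "g (s, z) - c \<in> cone"
      using eventually_happens[of _ "at_left t"] by auto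
    have "g (t, z) - g (s, z) \<in> cone"
      using s t by (intro mono) (auto simp: W_def cone_iff)
    then have "g (s, z) = c" using s t cone_antisym[of "g (s, z)" c] by (simp add: W_def)
    then show "\<exists>s<t. (s, z) \<in> W c" using s by (intro exI[of _ s]) (simp add: W_def)
  qed
  then have lim: "(\<lambda>n. \<Sum>c\<in>g ` \<Omega>. measure lborel (T c n) / k n) \<longlonglongrightarrow> 0"
    using tendsto_sum[of "g ` \<Omega>" "\<lambda>c n. measure lborel (T c n) / k n" "\<lambda>c. 0" sequentially] by simp
  show ?thesis
  proof (rule Lim_null_comparison[OF _ lim], intro always_eventually allI)
    fix n
    have "jumps (k n) \<subseteq> (\<Union>c\<in>g ` \<Omega>. T c n)"
      unfolding jumps_def T_def W_def by blast
    moreover have fm: "T c n \<in> fmeasurable lborel" for c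
    proof (rule fmeasurableI)
      have "T c n \<subseteq> W c" by (auto simp: T_def)
      then have "bounded (T c n)" using bdW by (rule bounded_subset[rotated])
      then show "emeasure lborel (T c n) < \<infinity>" by (rule emeasure_bounded_finite)
    qed simp
    ultimately have "measure lborel (jumps (k n)) \<le> measure lborel (\<Union>c\<in>g ` \<Omega>. T c n)"
      using fm fin by (intro measure_mono_fmeasurable fmeasurable.finite_UN) auto
    also have "\<dots> \<le> (\<Sum>c\<in>g ` \<Omega>. measure lborel (T c n))"
      using fin fm by (intro measure_UNION_le) (auto simp: fmeasurable_def)
    finally show "norm (measure lborel (jumps (k n)) / k n) \<le> (\<Sum>c\<in>g ` \<Omega>. measure lborel (T c n) / k n)"
      using k(1)[of n] by (simp add: sum_divide_distrib[symmetric] divide_right_mono)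
  qed
qed

text \<open>\<open>\<psi>\<close> is cut into the pieces \<open>\<psi> x * \<beta> (x + y)\<close>, which are integrated over \<open>y\<close>. On the support of a
  piece, \<open>g\<close> lies between its values at the points \<open>2 * h\<close> below and above \<open>- y\<close>, and a third value
  is only taken in \<open>jumps (4 * h)\<close>.\<close>

lemma smoothed_flux:
  fixes \<beta> :: "coord \<Rightarrow> real"
  assumes \<psi>: "test_function \<psi> D K" "\<And>x. \<psi> x \<ge> 0" "K \<subseteq> \<Omega>" "\<And>x. \<psi> x \<le> B1" "\<And>x. norm (D x) \<le> B2"
    and \<beta>: "test_function \<beta> D' (cball 0 h)" "\<And>x. \<beta> x \<ge> 0" "\<And>x. \<beta> x \<le> 1" "\<And>x. norm (D' x) \<le> N"
    and h: "h > 0" and room: "\<And>x. x \<in> K \<Longrightarrow> cball x (4 * h) \<subseteq> \<Omega>"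
    and M: "\<And>x. norm (g x) \<le> M"
  shows "(\<integral>x. \<beta> x \<partial>lborel) * (\<integral>x. reflect (g x) \<bullet> D x \<partial>lborel)
      \<le> 2 * M * ((B2 + B1 * N) * measure lborel (cball (0::coord) h)) * measure lborel (jumps (4 * h))"
proof -
  interpret \<psi>: test_function \<psi> D K by fact
  interpret \<beta>: test_function \<beta> D' "cball 0 h" by fact
  define \<theta> where "\<theta> y x = \<psi> x * \<beta> (x + y)" for x y
  define D\<theta> where "D\<theta> y x = \<beta> (x + y) *\<^sub>R D x + \<psi> x *\<^sub>R D' (x + y)" for x y
  \<comment> \<open>This shift makes \<open>- y - e\<close> and \<open>- y + e\<close> comparable
    with every point within \<open>h\<close> of \<open>- y\<close>.\<close>
  define e :: coord where "e = (2 * h, 0)"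
  have tf: "test_function (\<theta> y) (D\<theta> y) K" for y
    unfolding \<theta>_def D\<theta>_def using test_function_product[OF \<psi>(1) \<beta>(1)] .
  have M0: "M \<ge> 0" using M norm_ge_zero order_trans by blast
  have B1: "B1 \<ge> 0" using \<psi>(2,4) order_trans by blast
  have B2: "B2 \<ge> 0" using \<psi>(5) norm_ge_zero order_trans by blast
  have N: "N \<ge> 0" using \<beta>(4) norm_ge_zero order_trans by blast
  define C where "C = B2 + B1 * N"
  have C: "C \<ge> 0" using B1 B2 N by (simp add: C_def)
  define L where "L = {y. \<exists>x\<in>K. x + y \<in> cball 0 h}"
  have D\<theta>0: "D\<theta> y x = 0" if "x \<notin> K \<or> x + y \<notin> cball 0 h" for x y
    using that \<psi>.supp[of x] \<psi>.supp_gradient[of x] \<beta>.supp[of "x + y"] \<beta>.supp_gradient[of "x + y"]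
    by (auto simp: D\<theta>_def)
  have D\<theta>L: "D\<theta> y x = 0" if "x \<notin> K \<or> y \<notin> L" for x y
    using that by (intro D\<theta>0) (auto simp: L_def)
  have bK: "bounded K" using \<psi>.K by (rule compact_imp_bounded)
  have bL: "bounded L"
  proof -
    obtain R where R: "\<And>x. x \<in> K \<Longrightarrow> norm x \<le> R" using bK by (auto simp: bounded_iff)
    have "norm y \<le> h + R" if "y \<in> L" for y
    proof -
      obtain x where "x \<in> K" "norm (x + y) \<le> h" using \<open>y \<in> L\<close> by (auto simp: L_def)
      then show ?thesis using R[of x] norm_triangle_ineq4[of "x + y" x] by simp
    qed
    then show ?thesis unfolding bounded_iff by blast
  qed
  have norm_D\<theta>: "norm (D\<theta> y x) \<le> C" for x y
  proof -
    have "norm (D\<theta> y x) \<le> norm (\<beta> (x + y) *\<^sub>R D x) + norm (\<psi> x *\<^sub>R D' (x + y))"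
      unfolding D\<theta>_def by (rule norm_triangle_ineq)
    also have "norm (\<beta> (x + y) *\<^sub>R D x) \<le> 1 * B2"
      unfolding norm_scaleR using \<beta>(2,3) \<psi>(5) by (intro mult_mono) (auto simp: abs_of_nonneg)
    also have "norm (\<psi> x *\<^sub>R D' (x + y)) \<le> B1 * N"
      unfolding norm_scaleR using \<beta>(4) \<psi>(2,4) B1 by (intro mult_mono) (auto simp: abs_of_nonneg)
    finally show ?thesis by (simp add: C_def)
  qed
  have [measurable]: "(\<lambda>p::coord \<times> coord. fst p) \<in> borel_measurable borel" "(\<lambda>p::coord \<times> coord. snd p) \<in> borel_measurable borel"
    by (intro borel_measurable_continuous_onI continuous_intros)+
  have meas_D\<theta> [measurable]: "(\<lambda>p. D\<theta> (snd p) (fst p)) \<in> borel_measurable borel"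
    unfolding D\<theta>_def by measurable
  define P where "P x y = reflect (g x) \<bullet> D\<theta> y x" for x y
  define Q where "Q x y = indicat_real (jumps (4 * h)) x * norm (D\<theta> y x)" for x y
  have boundP: "\<bar>P x y\<bar> \<le> M * C" for x y
  proof -
    have "\<bar>P x y\<bar> \<le> norm (g x) * norm (D\<theta> y x)"
      using Cauchy_Schwarz_ineq2[of "reflect (g x)" "D\<theta> y x"] by (simp add: P_def)
    also have "\<dots> \<le> M * C" using M norm_D\<theta> M0 by (intro mult_mono) auto
    finally show ?thesis .
  qed
  have swapP: "(\<integral>y. \<integral>x. P x y \<partial>lborel \<partial>lborel) = (\<integral>x. \<integral>y. P x y \<partial>lborel \<partial>lborel)"
     "integrable lborel (\<lambda>y. \<integral>x. P x y \<partial>lborel)"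
  proof -
    have "(\<lambda>(x, y). P x y) \<in> borel_measurable borel"
      unfolding P_def case_prod_beta by measurable
    moreover have "P x y = 0" if "x \<notin> K \<or> y \<notin> L" for x y using D\<theta>L[OF that] by (simp add: P_def)
    ultimately show "(\<integral>y. \<integral>x. P x y \<partial>lborel \<partial>lborel) = (\<integral>x. \<integral>y. P x y \<partial>lborel \<partial>lborel)"
      "integrable lborel (\<lambda>y. \<integral>x. P x y \<partial>lborel)"
      using lborel_integral_swap[of P "M * C" K L] boundP bK bL by blast+
  qed
  have swapQ: "(\<integral>y. \<integral>x. Q x y \<partial>lborel \<partial>lborel) = (\<integral>x. \<integral>y. Q x y \<partial>lborel \<partial>lborel)"
     "integrable lborel (\<lambda>y. \<integral>x. Q x y \<partial>lborel)" "integrable lborel (\<lambda>x. \<integral>y. Q x y \<partial>lborel)"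
  proof -
    have "(\<lambda>(x, y). Q x y) \<in> borel_measurable borel"
      unfolding Q_def case_prod_beta by measurable
    moreover have "Q x y = 0" if "x \<notin> K \<or> y \<notin> L" for x y using D\<theta>L[OF that] by (simp add: Q_def)
    moreover have "\<bar>Q x y\<bar> \<le> C" for x y using norm_D\<theta> C by (auto simp: Q_def indicator_def)
    ultimately show "(\<integral>y. \<integral>x. Q x y \<partial>lborel \<partial>lborel) = (\<integral>x. \<integral>y. Q x y \<partial>lborel \<partial>lborel)"
      "integrable lborel (\<lambda>y. \<integral>x. Q x y \<partial>lborel)" "integrable lborel (\<lambda>x. \<integral>y. Q x y \<partial>lborel)"
      using lborel_integral_swap[of Q C K L] bK bL by blast+
  qed
  \<comment> \<open>Under integration over \<open>y\<close> the gradient of the bump drops out, its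
    integral being zero; the original integrand times the mass of \<beta> remains.\<close>
  have inner: "(\<integral>y. P x y \<partial>lborel) = (\<integral>y. \<beta> y \<partial>lborel) * (reflect (g x) \<bullet> D x)" for x
  proof -
    define F where "F w = \<beta> w * (reflect (g x) \<bullet> D x) + \<psi> x * (D' w \<bullet> reflect (g x))" for w
    have i1: "integrable lborel \<beta>" using \<beta>.integrable_times(1)[of "\<lambda>_. 1" 1] by simp
    have i2: "integrable lborel (\<lambda>w. D' w \<bullet> reflect (g x))"
      using \<beta>.integrable_times(2)[of "\<lambda>_. 1" 1] by (intro integrable_inner_left) simp_all
    have "P x y = F (y + x)" for y
      by (simp add: P_def D\<theta>_def F_def inner_add_right inner_commute add.commute)
    then have "(\<integral>y. P x y \<partial>lborel) = (\<integral>y. F (y + x) \<partial>lborel)" by simp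
    also have "\<dots> = (\<integral>w. F w \<partial>lborel)"
      unfolding F_def by (rule lborel_integral_translate) measurable
    also have "\<dots> = (\<integral>w. \<beta> w * (reflect (g x) \<bullet> D x) \<partial>lborel) + (\<integral>w. \<psi> x * (D' w \<bullet> reflect (g x)) \<partial>lborel)"
      unfolding F_def by (intro Bochner_Integration.integral_add integrable_mult_left integrable_mult_right i1 i2)
    also have "\<dots> = (\<integral>y. \<beta> y \<partial>lborel) * (reflect (g x) \<bullet> D x)"
      by (simp add: \<beta>.integral_gradient_zero)
    finally show ?thesis .
  qed
  have "(\<integral>y. \<beta> y \<partial>lborel) * (\<integral>x. reflect (g x) \<bullet> D x \<partial>lborel) = (\<integral>x. \<integral>y. P x y \<partial>lborel \<partial>lborel)"
    by (simp add: inner)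
  also have "\<dots> = (\<integral>y. \<integral>x. P x y \<partial>lborel \<partial>lborel)" by (simp add: swapP)
  also have "\<dots> \<le> (\<integral>y. 2 * M * (\<integral>x. Q x y \<partial>lborel) \<partial>lborel)"
  proof (rule integral_mono)
    fix y
    show "(\<integral>x. P x y \<partial>lborel) \<le> 2 * M * (\<integral>x. Q x y \<partial>lborel)"
    proof (cases "\<exists>x. \<theta> y x \<noteq> 0")
      case False
      then have z: "\<theta> y x = 0" for x by blast
      have "D\<theta> y x = 0" for x
        by (rule test_function.gradient_nonneg_zero[OF tf]) (simp_all only: z order_refl)
      then show ?thesis by (simp add: P_def Q_def)
    next
      case True
      \<comment> \<open>The points \<open>x - (4 * h, 0)\<close>, \<open>- y - e\<close>,
        \<open>x\<close>, \<open>- y + e\<close>, \<open>x + (4 * h, 0)\<close> form a chain in the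
        cone order inside \<Omega>.\<close>
      have near: "x \<in> \<Omega> \<and> - y - e \<in> \<Omega> \<and> - y + e \<in> \<Omega> \<and> x - (4 * h, 0) \<in> \<Omega> \<and> x + (4 * h, 0) \<in> \<Omega> \<and>
          x - (- y - e) \<in> cone \<and> (- y + e) - x \<in> cone \<and>
          (- y - e) - (x - (4 * h, 0)) \<in> cone \<and> (x + (4 * h, 0)) - (- y + e) \<in> cone"
        if "\<theta> y x \<noteq> 0" for x
      proof -
        have x: "x \<in> K" and xy: "norm (x + y) \<le> h"
          using that \<psi>.supp[of x] \<beta>.supp[of "x + y"] by (auto simp: \<theta>_def)
        have e: "norm e = 2 * h" "norm ((4 * h, 0) :: coord) = 4 * h" using h by (simp_all add: e_def)
        have in_\<Omega>: "z \<in> \<Omega>" if "norm (z - x) \<le> 4 * h" for z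
          using room[OF x] that by (auto simp: dist_norm norm_minus_commute)
        have "- y - e \<in> \<Omega>" "- y + e \<in> \<Omega>"
        proof -
          have eq: "- y - e - x = - (x + y + e)" "- y + e - x = e - (x + y)" by simp_all
          show "- y - e \<in> \<Omega>" "- y + e \<in> \<Omega>"
            by (rule in_\<Omega>, unfold eq norm_minus_cancel,
                use norm_triangle_ineq[of "x + y" e] norm_triangle_ineq4[of e "x + y"] xy e h in linarith)+
        qed
        moreover have "x \<in> \<Omega>" "x - (4 * h, 0) \<in> \<Omega>" "x + (4 * h, 0) \<in> \<Omega>"
          using e(2) h by (auto intro!: in_\<Omega>)
        moreover have "(x + y) + e \<in> cone" "- (x + y) + e \<in> cone"
          using xy shifted_small_in_cone[of "x + y" h] shifted_small_in_cone[of "- (x + y)" h]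
          unfolding e_def norm_minus_cancel by auto
        moreover have "(4 * h, 0) = e + e" by (simp add: e_def)
        ultimately show ?thesis by (simp add: algebra_simps)
      qed
      have tf0: "\<theta> y x \<ge> 0" for x using \<psi>(2) \<beta>(2) by (simp add: \<theta>_def)
      have M2: "norm (g x - g (- y - e)) \<le> 2 * M" for x
        using norm_triangle_ineq4[of "g x" "g (- y - e)"] M[of x] M[of "- y - e"] by simp
      have "(\<integral>x. reflect (g x) \<bullet> D\<theta> y x \<partial>lborel) \<le> 2 * M * (\<integral>x. indicator (jumps (4 * h)) x * norm (D\<theta> y x) \<partial>lborel)"
      proof (rule gradient_flux_two_values[OF tf tf0 _ mono _ jumps_measurable measurable_g _ _ _ M2, where b = "g (- y + e)"])
        obtain x where "\<theta> y x \<noteq> 0" using True by blast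
        note x = near[OF this]
        then have "(- y + e) - (- y - e) \<in> cone" using cone_trans by blast
        then show "g (- y + e) - g (- y - e) \<in> cone" using x mono by blast
      next
        show "{x \<in> \<Omega>. g x - g (- y + e) \<in> cone} \<in> sets borel" by (rule borel_open[OF open_superlevel])
      next
        fix x assume x: "\<theta> y x \<noteq> 0"
        then show "x \<in> \<Omega>" using near by blast
        show "g (- y + e) - g x \<in> cone" using near[OF x] mono by blast
        assume "x \<notin> jumps (4 * h)"
        \<comment> \<open>If \<open>g\<close> does not change on one side, then \<open>x\<close> and
          its neighbour on that side enclose \<open>- y - e\<close> or \<open>- y + e\<close>, whose
          value is therefore the same.\<close>
        then consider "g (x - (4 * h, 0)) = g x" | "g (x + (4 * h, 0)) = g x"
          using near[OF x] by (auto simp: jumps_def)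
        then show "g x = g (- y - e) \<or> g x = g (- y + e)"
        proof cases
          case 1
          then show ?thesis using near[OF x] mono[of "- y - e" x] mono[of "x - (4 * h, 0)" "- y - e"] cone_antisym by metis
        next
          case 2
          then show ?thesis using near[OF x] mono[of x "- y + e"] mono[of "- y + e" "x + (4 * h, 0)"] cone_antisym by metis
        qed
      qed
      then show ?thesis by (simp add: P_def Q_def)
    qed
  qed (use swapP swapQ in auto)
  also have "\<dots> = 2 * M * (\<integral>x. \<integral>y. Q x y \<partial>lborel \<partial>lborel)" by (simp add: swapQ)
  also have "\<dots> \<le> 2 * M * (\<integral>x. C * measure lborel (cball (0::coord) h) * indicator (jumps (4 * h)) x \<partial>lborel)"
  proof (intro mult_left_mono integral_mono)
    have bj: "bounded (jumps (4 * h))" using bounded_\<Omega> by (rule bounded_subset) (auto simp: jumps_def)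
    show "integrable lborel (\<lambda>x. C * measure lborel (cball (0::coord) h) * indicator (jumps (4 * h)) x)"
      using emeasure_bounded_finite[OF bj] by (intro integrable_mult_right integrable_real_indicator) auto
    fix x
    \<comment> \<open>As a function of \<open>y\<close> the gradient vanishes off the ball of radius
      \<open>h\<close> about \<open>- x\<close>, so each jump point costs at most \<open>C\<close>
      times the volume of that ball.\<close>
    have "(\<integral>y. norm (D\<theta> y x) \<partial>lborel) \<le> (\<integral>y. C * indicator (cball (- x) h) y \<partial>lborel)"
    proof (rule integral_mono')
      show "integrable lborel (\<lambda>y. C * indicator (cball (- x) h) y)"
        by (intro integrable_mult_right integrable_indicator_cball)
      show "norm (D\<theta> y x) \<le> C * indicator (cball (- x) h) y" for y
        using norm_D\<theta>[of y x] D\<theta>0[of x y] by (auto simp: indicator_def dist_norm norm_minus_commute add.commute)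
    qed (use C in auto)
    also have "\<dots> = C * measure lborel (cball (0::coord) h)"
      using content_cball[of h "- x"] content_cball[of h "0::coord"] h by simp
    finally show "(\<integral>y. Q x y \<partial>lborel) \<le> C * measure lborel (cball (0::coord) h) * indicator (jumps (4 * h)) x"
      by (simp add: Q_def indicator_def)
  qed (use swapQ M0 in auto)
  also have "\<dots> = 2 * M * (C * measure lborel (cball (0::coord) h)) * measure lborel (jumps (4 * h))"
    by simp
  finally show ?thesis by (simp add: C_def)
qed

text \<open>The cut-off at scale \<open>h\<close> costs a factor \<open>1 / h\<close>, the set
  \<open>jumps (4 * h)\<close> has measure \<open>o(h)\<close>, and the volume of the small ball
  cancels; so a positive flux would be bounded by a null sequence.\<close>

lemma reflected_flux_nonpos:
  assumes \<psi>: "test_function \<psi> D K" "\<And>x. \<psi> x \<ge> 0" "K \<subseteq> \<Omega>"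
  shows "(\<integral>x. reflect (g x) \<bullet> D x \<partial>lborel) \<le> 0"
proof -
  interpret \<psi>: test_function \<psi> D K by fact
  obtain B1 where B1: "B1 > 0" "\<And>x. \<bar>\<psi> x\<bar> \<le> B1" using \<psi>.bounded_\<theta> by blast
  obtain B2 where B2: "B2 > 0" "\<And>x. norm (D x) \<le> B2" using \<psi>.gradient_bounded by blast
  obtain M where M: "M > 0" "\<And>x. norm (g x) \<le> M" using bounded_g by blast
  obtain \<delta> where \<delta>: "\<delta> > 0" "(\<Union>x\<in>K. ball x \<delta>) \<subseteq> \<Omega>"
    using compact_subset_open_imp_ball_epsilon_subset[OF \<psi>.K open_\<Omega> \<psi>(3)] by blast
  \<comment> \<open>The factor \<open>1 / 8\<close> gives \<open>4 * h n \<le> \<delta> / 2\<close>,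
    so the shifted points stay within the margin \<delta>.\<close>
  define h where "h n = \<delta> / 8 * inverse (real (Suc n))" for n
  have h: "h n > 0" "4 * h n < \<delta>" for n
    using \<delta>(1) by (simp_all add: h_def field_simps add_pos_nonneg)
  have h0: "h \<longlonglongrightarrow> 0"
    unfolding h_def by (rule tendsto_mult_right_zero[OF LIMSEQ_inverse_real_of_nat])
  define I where "I = (\<integral>x. reflect (g x) \<bullet> D x \<partial>lborel)"
  \<comment> \<open>\<open>256 / 9\<close> is \<open>2 * 128 / 9\<close>, and the bracket is
    \<open>4 * h n\<close> times \<open>B2 + B1 * (4 / h n)\<close>; thus \<open>c n\<close> stays
    bounded.\<close>
  define c where "c n = 256 / 9 * M * (B2 * (4 * h n) + 16 * B1)" for n
  have bound: "I \<le> c n * (measure lborel (jumps (4 * h n)) / (4 * h n))" if "I > 0" for n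
  proof -
    let ?\<beta> = "\<lambda>w::coord. bump ((1 / h n) *\<^sub>R w)"
    let ?D = "\<lambda>w::coord. (1 / h n) *\<^sub>R bump_gradient ((1 / h n) *\<^sub>R w)"
    let ?V = "measure lborel (cball (0::coord) (h n))"
    let ?m = "measure lborel (jumps (4 * h n))"
    interpret \<beta>: test_function ?\<beta> ?D "cball 0 (h n)" using h(1) by (rule test_function_bump)
    \<comment> \<open>In dimension three, half the radius leaves an eighth of the volume; together
      with \<open>9 / 16\<close> this makes \<open>9 / 128\<close>.\<close>
    have V: "measure lborel (cball (0::coord) (h n / 2)) = ?V / 8" "?V > 0"
      using h(1)[of n] content_cball[of "h n / 2" "0::coord"] content_cball[of "h n" "0::coord"]
      by (simp_all add: power3_eq_cube)
    have "(\<integral>x. 9 / 16 * indicator (cball (0::coord) (h n / 2)) x \<partial>lborel) \<le> (\<integral>x. ?\<beta> x \<partial>lborel)"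
    proof (rule integral_mono)
      show "integrable lborel (\<lambda>x. 9 / 16 * indicator (cball (0::coord) (h n / 2)) x :: real)"
        by (intro integrable_mult_right integrable_indicator_cball)
      show "integrable lborel ?\<beta>" using \<beta>.integrable_times(1)[of "\<lambda>x. 1" 1] by simp
      show "9 / 16 * indicator (cball (0::coord) (h n / 2)) x \<le> ?\<beta> x" for x
        using bump_ge[of "(1 / h n) *\<^sub>R x"] bump_bounds(1)[of "(1 / h n) *\<^sub>R x"] h(1)[of n]
        by (auto simp: indicator_def field_simps)
    qed
    then have "9 / 128 * ?V \<le> (\<integral>x. ?\<beta> x \<partial>lborel)" using V by simp
    then have "9 / 128 * ?V * I \<le> (\<integral>x. ?\<beta> x \<partial>lborel) * I"
      using that by (intro mult_right_mono) auto
    also have "\<dots> \<le> 2 * M * ((B2 + B1 * (4 / h n)) * ?V) * ?m"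
      unfolding I_def
    proof (rule smoothed_flux[OF \<psi> _ B2(2) \<beta>.test_function_axioms bump_bounds _ h(1) _ M(2)])
      show "\<psi> x \<le> B1" for x using B1(2)[of x] by simp
      show "norm (?D x) \<le> 4 / h n" for x
        using norm_bump_gradient[of "(1 / h n) *\<^sub>R x"] h(1)[of n] by (simp add: divide_right_mono)
      show "cball x (4 * h n) \<subseteq> \<Omega>" if "x \<in> K" for x
      proof -
        have "cball x (4 * h n) \<subseteq> ball x \<delta>" using h(2)[of n] by (simp add: cball_subset_ball_iff)
        then show ?thesis using \<delta>(2) that by blast
      qed
    qed
    finally have "?V * (9 / 128 * I) \<le> ?V * (2 * M * (B2 + B1 * (4 / h n)) * ?m)" by (simp only: mult_ac)
    then have "9 / 128 * I \<le> 2 * M * (B2 + B1 * (4 / h n)) * ?m" using V(2) by (rule mult_left_le_imp_le)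
    then have "I \<le> 256 / 9 * M * (B2 + B1 * (4 / h n)) * ?m" by simp
    also have "\<dots> = c n * (?m / (4 * h n))" using h(1)[of n] by (simp add: c_def field_simps)
    finally show ?thesis .
  qed
  have "(\<lambda>n. c n * (measure lborel (jumps (4 * h n)) / (4 * h n))) \<longlonglongrightarrow> (256 / 9 * M * (B2 * (4 * 0) + 16 * B1)) * 0"
    unfolding c_def
  proof (intro tendsto_mult tendsto_add tendsto_const h0)
    show "(\<lambda>n. measure lborel (jumps (4 * h n)) / (4 * h n)) \<longlonglongrightarrow> 0"
      using h tendsto_mult_right_zero[OF h0, of 4] by (intro jumps_small) auto
  qed
  then have "I \<le> 0" if "I > 0"
    using bound[OF that] by (intro LIMSEQ_le_const[of _ 0 I]) auto
  then show ?thesis unfolding I_def by linarith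
qed

lemma not_close_to_identity:
  assumes \<psi>: "test_function \<psi> D K" "\<And>x. \<psi> x \<ge> 0" "K \<subseteq> \<Omega>" "(\<integral>x. \<psi> x \<partial>lborel) = 1"
    and close: "\<And>x. x \<in> \<Omega> \<Longrightarrow> norm (x - g x) \<le> \<eta>"
  shows "1 \<le> \<eta> * (\<integral>x. norm (D x) \<partial>lborel)"
proof -
  interpret test_function \<psi> D K by fact
  have D0: "D x = 0" if "x \<notin> \<Omega>" for x using that \<psi>(3) supp_gradient by blast
  obtain M where M: "M > 0" "\<And>x. norm (g x) \<le> M" using bounded_g by blast
  obtain N where N: "\<And>x. norm (D x) \<le> N" using gradient_bounded by blast
  have ig: "integrable lborel (\<lambda>x. reflect (g x) \<bullet> D x)"
  proof -
    have "norm (reflect (g x) \<bullet> D x) \<le> M * N" for x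
    proof -
      have "norm (reflect (g x) \<bullet> D x) \<le> norm (g x) * norm (D x)"
        using Cauchy_Schwarz_ineq2[of "reflect (g x)" "D x"] by simp
      also have "\<dots> \<le> M * N" using M N by (intro mult_mono) (auto intro: less_imp_le)
      finally show ?thesis .
    qed
    then show ?thesis using compact_imp_bounded[OF K] supp_gradient
      by (intro integrable_bounded_support[of _ "M * N" K]) simp_all
  qed
  have ic: "integrable lborel (\<lambda>x. (x \<bullet> i) * (D x \<bullet> i))" for i
  proof -
    obtain R where R: "R > 0" "\<And>x. x \<in> K \<Longrightarrow> norm x \<le> R"
      using compact_imp_bounded[OF K] by (auto simp: bounded_pos)
    have "norm ((x \<bullet> i) * (D x \<bullet> i)) \<le> (R * norm i) * (N * norm i)" for x
    proof (cases "x \<in> K")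
      case True
      have "\<bar>x \<bullet> i\<bar> \<le> R * norm i" "\<bar>D x \<bullet> i\<bar> \<le> N * norm i"
        using Cauchy_Schwarz_ineq2[of x i] mult_right_mono[OF R(2)[OF True] norm_ge_zero[of i]]
          Cauchy_Schwarz_ineq2[of "D x" i] mult_right_mono[OF N[of x] norm_ge_zero[of i]] by linarith+
      then show ?thesis unfolding real_norm_def abs_mult by (intro mult_mono) (use R in auto)
    next
      case False
      moreover have "N \<ge> 0" using N norm_ge_zero order_trans by blast
      ultimately show ?thesis using R(1) by (simp add: supp_gradient)
    qed
    then show ?thesis using compact_imp_bounded[OF K] supp_gradient
      by (intro integrable_bounded_support[of _ "(R * norm i) * (N * norm i)" K]) simp_all
  qed
  \<comment> \<open>Twice the first coordinate product minus the full inner product: in this form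
    \<open>integral_coordinate_gradient\<close> treats all basis vectors alike.\<close>
  have expand: "reflect x \<bullet> y = 2 * ((x \<bullet> (1, 0)) * (y \<bullet> (1, 0))) - (\<Sum>i\<in>Basis. (x \<bullet> i) * (y \<bullet> i))" for x y :: coord
  proof -
    have "x \<bullet> y = (\<Sum>i\<in>Basis. (x \<bullet> i) * (y \<bullet> i))" by (rule euclidean_inner)
    then show ?thesis by (simp add: reflect_def inner_prod_def)
  qed
  have B1: "(1, 0) \<in> (Basis :: coord set)" by (simp add: Basis_prod_def)
  have ii: "integrable lborel (\<lambda>x. reflect x \<bullet> D x)"
    unfolding expand by (intro Bochner_Integration.integrable_diff integrable_mult_right Bochner_Integration.integrable_sum ic)
  have "(\<integral>x. reflect x \<bullet> D x \<partial>lborel) =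
      2 * (\<integral>x. (x \<bullet> (1, 0)) * (D x \<bullet> (1, 0)) \<partial>lborel) - (\<Sum>i\<in>Basis. \<integral>x. (x \<bullet> i) * (D x \<bullet> i) \<partial>lborel)"
    unfolding expand
    by (subst Bochner_Integration.integral_diff, intro integrable_mult_right ic,
        intro Bochner_Integration.integrable_sum ic, subst Bochner_Integration.integral_sum, rule ic) simp
  \<comment> \<open>The basis has three elements, so the value is \<open>- 2 + 3\<close>.\<close>
  also have "\<dots> = 2 * (- 1) - (\<Sum>i\<in>(Basis::coord set). - 1)"
    using integral_coordinate_gradient[OF B1] integral_coordinate_gradient \<psi>(4) by simp
  also have "\<dots> = 1" by simp
  finally have "1 \<le> (\<integral>x. reflect x \<bullet> D x \<partial>lborel) - (\<integral>x. reflect (g x) \<bullet> D x \<partial>lborel)"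
    using reflected_flux_nonpos[OF \<psi>(1-3)] by simp
  also have "\<dots> = (\<integral>x. reflect x \<bullet> D x - reflect (g x) \<bullet> D x \<partial>lborel)"
    using ii ig by simp
  also have "\<dots> \<le> (\<integral>x. \<eta> * norm (D x) \<partial>lborel)"
  proof (rule integral_mono)
    have "integrable lborel D" using integrable_times(2)[of "\<lambda>_. 1" 1] by simp
    then show "integrable lborel (\<lambda>x. \<eta> * norm (D x))" by simp
    fix x
    have "reflect x \<bullet> D x - reflect (g x) \<bullet> D x = reflect (x - g x) \<bullet> D x"
      by (simp add: reflect_diff inner_diff_left)
    also have "\<dots> \<le> norm (x - g x) * norm (D x)"
      using norm_cauchy_schwarz[of "reflect (x - g x)" "D x"] by simp
    also have "\<dots> \<le> \<eta> * norm (D x)"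
      using close[of x] D0[of x] by (cases "x \<in> \<Omega>") (auto intro: mult_right_mono)
    finally show "reflect x \<bullet> D x - reflect (g x) \<bullet> D x \<le> \<eta> * norm (D x)" .
  qed (use ii ig in simp)
  finally show ?thesis by simp
qed

end

section \<open>From disks to the cone-ordered half-space, and the two conclusions\<close>

section \<open>Disks in coordinates\<close>

lemma interior_cone_iff: "p \<in> interior cone \<longleftrightarrow> norm (snd p) < fst p"
proof
  assume "p \<in> interior cone"
  then obtain e where e: "e > 0" "ball p e \<subseteq> cone" by (auto simp: mem_interior)
  have "p - (e / 2, 0) \<in> ball p e" using e(1) by (simp add: dist_norm norm_Pair)
  then have "p - (e / 2, 0) \<in> cone" using e(2) by blast
  then show "norm (snd p) < fst p" using e(1) by (simp add: cone_iff)
next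
  have "open {p :: coord. norm (snd p) < fst p}"
    by (intro open_Collect_less continuous_intros)
  then have "{p. norm (snd p) < fst p} \<subseteq> interior cone"
    by (rule interior_maximal[rotated]) (auto simp: cone_iff)
  then show "norm (snd p) < fst p \<Longrightarrow> p \<in> interior cone" by blast
qed

lemma disk_subset_iff:
  "q \<in> H_coord \<Longrightarrow> disk q \<subseteq> disk p \<longleftrightarrow> q - p \<in> cone"
  by (auto simp: disk_def cball_subset_cball_iff cone_iff H_coord_def dist_norm)

lemma disk_in_Disc: "p \<in> H_coord \<Longrightarrow> disk p \<in> carrier Disc"
  by (auto simp: disk_def H_coord_def)

lemma disk_inj: "p \<in> H_coord \<Longrightarrow> q \<in> H_coord \<Longrightarrow> disk p = disk q \<Longrightarrow> p = q"
  using disk_subset_iff[of p q] disk_subset_iff[of q p] cone_antisym[of p q] by simp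

lemma way_below_disk:
  assumes "p \<in> H_coord" "q \<in> H_coord" "q - p \<in> interior cone"
  shows "way_below Disc (disk p) (disk q)"
proof -
  have "disk q \<subseteq> interior (disk p)"
    using assms(3) by (simp add: disk_def cball_subset_ball_iff interior_cone_iff dist_norm)
  then show ?thesis using assms(1,2) by (simp add: way_below_Disc disk_in_Disc)
qed

text \<open>The interval between \<open>0\<close> and \<open>\<eta> *\<^sub>R e_dir\<close> is a
  double cone: \<open>norm z\<close> is at most \<open>t\<close> and at most
  \<open>\<eta> - t\<close>, so the squared norm is at most \<open>t * \<eta>\<close>. No constant
  is lost, as the final contradiction with \<open>\<eta> * L_grad \<psi> < 1\<close>
  requires.\<close>

lemma norm_le_of_cone_interval:
  assumes "d \<in> cone" "\<eta> *\<^sub>R e_dir - d \<in> cone"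
  shows "norm d \<le> \<eta>"
proof -
  obtain t z where d: "d = (t, z)" by (cases d)
  have *: "norm z \<le> t" "norm z \<le> \<eta> - t"
    using assms by (simp_all add: d cone_iff e_dir_def)
  then have t: "0 \<le> t" "0 \<le> \<eta> - t" using norm_ge_zero[of z] by linarith+
  have "(norm z)\<^sup>2 \<le> t * (\<eta> - t)"
    unfolding power2_eq_square using * t by (intro mult_mono) auto
  then have "t\<^sup>2 + (norm z)\<^sup>2 \<le> t * \<eta>" by (simp add: power2_eq_square algebra_simps)
  also have "\<dots> \<le> \<eta>\<^sup>2" unfolding power2_eq_square using t by (intro mult_right_mono) auto
  finally have "sqrt (t\<^sup>2 + (norm z)\<^sup>2) \<le> sqrt (\<eta>\<^sup>2)" by (rule real_sqrt_le_mono)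
  then show ?thesis using t by (simp add: d norm_Pair)
qed

lemma Omega_box_eq: "Omega_box = {-6<..<-4} \<times> box (\<chi> i. -1) (\<chi> i. 1)"
  by (auto simp: Omega_box_def mem_box_cart)

lemma open_Omega_box: "open Omega_box"
  unfolding Omega_box_eq by (intro open_Times) auto

lemma bounded_Omega_box: "bounded Omega_box"
  unfolding Omega_box_eq by (intro bounded_Times bounded_box bounded_subset[OF bounded_closed_interval[of "-6" "-4::real"]]) auto

lemma convex_Omega_box: "convex Omega_box"
  unfolding Omega_box_eq by (intro convex_Times) auto

lemma compact_P_box: "compact P_box"
proof -
  have "P_box = {-6..-4} \<times> cbox (\<chi> i. -1) (\<chi> i. 1)"
    by (auto simp: P_box_def mem_box_cart)
  moreover have "compact ({-6..-4::real} \<times> cbox (\<chi> i. -1) (\<chi> i. 1) :: coord set)"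
    by (intro compact_Times compact_Icc compact_cbox)
  ultimately show ?thesis by (simp only:)
qed

lemma Omega_box_subset_P_box: "Omega_box \<subseteq> P_box"
  by (force simp: Omega_box_def P_box_def intro: less_imp_le)

lemma P_box_subset_H: "P_box \<subseteq> H_coord"
  by (auto simp: P_box_def H_coord_def)

section \<open>Approximations of \<open>Q\<close> and step fields\<close>

text \<open>Stated through \<open>near\<close> so that it serves both conclusions: the value at
  \<open>x\<close> has to contain some disk that lies above \<open>x\<close> after a shift by
  \<open>\<eta> *\<^sub>R e_dir\<close>, whether a step map or a supposed approximation put it
  there.\<close>

lemma approximant_coarse:
  assumes wb: "way_below (fun_space Disc (E_poset Disc)) \<phi> (Q_map Disc)"
    and near: "\<And>x. x \<in> Omega_box \<Longrightarrow>
      \<exists>u\<in>H_coord. disk u \<in> fst (\<phi> (disk x)) \<and> u + \<eta> *\<^sub>R e_dir - x \<in> cone"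
    and \<psi>: "test_function \<psi> D K" "\<And>x. \<psi> x \<ge> 0" "K \<subseteq> Omega_box" "(\<integral>x. \<psi> x \<partial>lborel) = 1"
  shows "1 \<le> \<eta> * (\<integral>x. norm (D x) \<partial>lborel)"
proof -
  let ?FS = "fun_space Disc (E_poset Disc)"
  let ?A = "\<lambda>x. fst (\<phi> (disk x))"
  have \<phi>: "\<phi> \<in> carrier ?FS" using wb by (simp add: way_below_def)
  have \<Omega>H: "x \<in> H_coord" if "x \<in> Omega_box" for x
    using that Omega_box_subset_P_box P_box_subset_H by blast
  have le: "\<phi> x \<sqsubseteq>\<^bsub>E_poset Disc\<^esub> Q_map Disc x" if "x \<in> carrier Disc" for x
    using way_below_imp_le[OF wb] that by simp
  obtain F where F: "finite F" "\<And>x. x \<in> carrier Disc \<Longrightarrow> fst (\<phi> x) \<subseteq> F"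
    by (rule way_below_fun_space_finite_range[OF wb]) (auto simp: Q_map_def down_wb_def way_below_Disc)
  have "\<exists>c. c \<in> H_coord \<and> disk c \<in> ?A x \<and> (\<forall>a\<in>?A x. disk c \<subseteq> a)" if x: "x \<in> Omega_box" for x
  proof -
    obtain u where u: "disk u \<in> ?A x" using near[OF x] by blast
    have dx: "disk x \<in> carrier Disc" using \<Omega>H[OF x] by (rule disk_in_Disc)
    have "\<phi> (disk x) \<in> carrier (E_poset Disc)"
      using \<phi> dx unfolding fun_space_carrier scott_continuous_def by (meson PiE)
    moreover have "snd (\<phi> (disk x)) = 0" using le[OF dx] dx by (simp add: Q_map_def)
    ultimately have dir: "directed Disc (?A x)" using u by (auto simp: E_poset_carrier)
    have "finite (?A x)" using F dx finite_subset by blast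
    then obtain m where m: "m \<in> ?A x" "\<And>a. a \<in> ?A x \<Longrightarrow> m \<subseteq> a"
      using directed_finite_upper_bound[OF dir, of "?A x"] by (metis Disc_le order_trans order_refl)
    \<comment> \<open>The bounded disk supplied by \<open>near\<close> keeps the greatest element
      from being the plane, so it has coordinates.\<close>
    have "m \<noteq> UNIV"
    proof
      assume "m = UNIV"
      then have "disk u = UNIV" using m(2)[OF u] by blast
      then show False using bounded_cball[of "snd u" "- fst u"] not_bounded_UNIV by (simp add: disk_def)
    qed
    moreover have "m \<in> carrier Disc" using m(1) dir by (auto simp: directed_def)
    ultimately obtain z r where "m = cball z r" "r \<ge> 0" by (auto simp: Disc_carrier)
    then have "(- r, z) \<in> H_coord \<and> disk (- r, z) = m" by (simp add: H_coord_def disk_def)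
    then show ?thesis using m by (intro exI[of _ "(- r, z)"]) simp
  qed
  then obtain c where c: "\<And>x. x \<in> Omega_box \<Longrightarrow> c x \<in> H_coord"
    "\<And>x. x \<in> Omega_box \<Longrightarrow> disk (c x) \<in> ?A x"
    "\<And>x a. x \<in> Omega_box \<Longrightarrow> a \<in> ?A x \<Longrightarrow> disk (c x) \<subseteq> a" by metis
  define g where "g x = (if x \<in> Omega_box then c x else 0)" for x
  \<comment> \<open>Monotonicity and lower semicontinuity both reduce to this: as long as the disk
    chosen at \<open>x\<close> belongs to the value at \<open>y\<close>, it lies below the disk
    chosen at \<open>y\<close>.\<close>
  have cone_c: "c y - c x \<in> cone" if "x \<in> Omega_box" "y \<in> Omega_box" "disk (c x) \<in> ?A y" for x y
    using disk_subset_iff[of "c y" "c x"] c(1)[OF that(2)] c(3)[OF that(2,3)] by simp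
  interpret step_field Omega_box g
  proof
    show "finite (g ` Omega_box)"
    proof -
      have "disk ` (c ` Omega_box) \<subseteq> F" using c(2) F(2)[OF disk_in_Disc[OF \<Omega>H]] by blast
      then have "finite (disk ` (c ` Omega_box))" using F(1) finite_subset by blast
      moreover have "inj_on disk (c ` Omega_box)" using c(1) disk_inj by (intro inj_onI) blast
      ultimately have "finite (c ` Omega_box)" by (rule finite_imageD)
      moreover have "g ` Omega_box = c ` Omega_box" by (rule image_cong) (simp_all add: g_def)
      ultimately show ?thesis by simp
    qed
  next
    fix x y assume xy: "x \<in> Omega_box" "y \<in> Omega_box" "y - x \<in> cone"
    have "?A x \<subseteq> ?A y"
      using xy by (intro fun_space_fst_mono[OF \<phi>]) (simp_all add: disk_in_Disc \<Omega>H disk_subset_iff)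
    then show "g y - g x \<in> cone" using cone_c[OF xy(1,2)] c(2)[OF xy(1)] xy(1,2) by (auto simp: g_def)
  next
    fix x assume x: "x \<in> Omega_box"
    \<comment> \<open>Scott continuity along these shrinking disks puts \<open>disk (c x)\<close>
      into the value at some \<open>d n\<close>, and the points above that disk include a
      neighbourhood of \<open>x\<close>.\<close>
    define d where "d n = cball (snd x) (- fst x + inverse (real (Suc n)))" for n
    have r: "- fst x \<ge> 0" using \<Omega>H[OF x] by (auto simp: H_coord_def)
    have dir: "directed Disc (range d)" "\<Inter> (range d) = disk x"
      using cball_shrinking[OF r, of "snd x"] by (simp_all add: d_def disk_def)
    then have "least Disc (disk x) (Upper Disc (range d))"
      by (subst least_Upper_Disc) (auto simp: directed_def disk_in_Disc \<Omega>H x)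
    then obtain n where n: "disk (c x) \<in> fst (\<phi> (d n))"
      using scott_continuous_fst_subset_Union[OF \<phi> dir(1)] c(2)[OF x] by blast
    define q where "q = x - (inverse (real (Suc n)), 0)"
    have "inverse (real (Suc n)) \<ge> 0" by simp
    then have "fst q \<le> 0" unfolding q_def using r by (simp only: fst_diff fst_conv)
    then have q: "q \<in> H_coord" "d n = disk q"
      by (simp_all add: q_def d_def disk_def H_coord_def mem_Times_iff)
    define O' where "O' = Omega_box \<inter> (\<lambda>y. y - q) -` interior cone"
    have "open O'" unfolding O'_def
      by (intro open_Int open_Omega_box open_vimage continuous_intros) auto
    moreover have "x \<in> O'" using x by (simp add: O'_def q_def interior_cone_iff)
    moreover have "g y - g x \<in> cone" if y: "y \<in> O'" for y
    proof -
      have "disk y \<subseteq> disk q"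
        using y interior_subset \<Omega>H by (subst disk_subset_iff) (auto simp: O'_def)
      then have "fst (\<phi> (disk q)) \<subseteq> ?A y"
        using y by (intro fun_space_fst_mono[OF \<phi>]) (auto simp: O'_def disk_in_Disc \<Omega>H q(1))
      then show ?thesis using n q x y cone_c[of x y] by (auto simp: g_def O'_def)
    qed
    ultimately show "\<forall>\<^sub>F y in nhds x. g y - g x \<in> cone" unfolding eventually_nhds by blast
  qed (auto simp: open_Omega_box bounded_Omega_box convex_Omega_box g_def)
  show ?thesis
  proof (rule not_close_to_identity[OF \<psi>])
    fix x assume x: "x \<in> Omega_box"
    have dx: "disk x \<in> carrier Disc" using \<Omega>H[OF x] by (rule disk_in_Disc)
    obtain u where u: "disk u \<in> ?A x" "u + \<eta> *\<^sub>R e_dir - x \<in> cone" using near[OF x] by blast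
    have "disk (c x) \<in> down_wb Disc (disk x)" using le[OF dx] c(2)[OF x] dx by (auto simp: Q_map_def)
    then have "disk x \<subseteq> disk (c x)" using interior_subset by (auto simp: down_wb_def way_below_Disc)
    then have 1: "x - c x \<in> cone" using \<Omega>H[OF x] by (simp add: disk_subset_iff)
    have "c x - u \<in> cone" using c(1)[OF x] c(3)[OF x u(1)] by (simp add: disk_subset_iff)
    then have "(c x - u) + (u + \<eta> *\<^sub>R e_dir - x) \<in> cone" using u(2) by (rule cone_add)
    moreover have "(c x - u) + (u + \<eta> *\<^sub>R e_dir - x) = \<eta> *\<^sub>R e_dir - (x - c x)" by simp
    ultimately have "\<eta> *\<^sub>R e_dir - (x - c x) \<in> cone" by (simp only:)
    then show "norm (x - g x) \<le> \<eta>" using norm_le_of_cone_interval[OF 1] x by (simp add: g_def)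
  qed
qed

section \<open>Smooth functions are test functions\<close>

text \<open>\<open>gradient\<close> is a definite description; it is identified with the vector of
  partial derivatives, whose continuity is the case \<open>k = 1\<close> of
  \<open>Ck\<close>.\<close>

lemma test_function_Cc_infinity:
  assumes "\<psi> \<in> Cc_infinity U"
  shows "test_function \<psi> (gradient \<psi>) (closure {x. \<psi> x \<noteq> 0})"
proof -
  define D where "D x = (\<Sum>i\<in>Basis. frechet_derivative \<psi> (at x) i *\<^sub>R i)" for x
  have "Ck 1 \<psi>" using assms by (simp add: Cc_infinity_def)
  then have diff: "\<psi> differentiable (at x)"
    and cont: "continuous_on UNIV (\<lambda>x. frechet_derivative \<psi> (at x) v)" for x v by simp_all
  have der: "(\<psi> has_derivative (\<lambda>h. h \<bullet> D x)) (at x)" for x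
  proof -
    have fd: "(\<psi> has_derivative frechet_derivative \<psi> (at x)) (at x)"
      using diff frechet_derivative_works by blast
    then interpret linear "frechet_derivative \<psi> (at x)" by (rule has_derivative_linear)
    have "frechet_derivative \<psi> (at x) h = h \<bullet> D x" for h
    proof -
      have "frechet_derivative \<psi> (at x) h = frechet_derivative \<psi> (at x) (\<Sum>i\<in>Basis. (h \<bullet> i) *\<^sub>R i)"
        by (simp add: euclidean_representation)
      also have "\<dots> = h \<bullet> D x" by (simp add: sum scale D_def inner_sum_right mult.commute)
      finally show ?thesis .
    qed
    then have "frechet_derivative \<psi> (at x) = (\<lambda>h. h \<bullet> D x)" by blast
    then show ?thesis using fd by simp
  qed
  have "gradient \<psi> x = D x" for x
    unfolding gradient_def
  proof (rule the_equality)
    show "GDERIV \<psi> x :> D x" using der by (simp add: gderiv_def)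
    show "E = D x" if "GDERIV \<psi> x :> E" for E
    proof -
      have "(\<lambda>h. h \<bullet> E) = (\<lambda>h. h \<bullet> D x)"
        using that der has_derivative_unique unfolding gderiv_def by blast
      then have "(E - D x) \<bullet> (E - D x) = 0" by (metis inner_diff_right right_minus_eq)
      then show ?thesis by simp
    qed
  qed
  then have "gradient \<psi> = D" by blast
  moreover have "continuous_on UNIV D" unfolding D_def by (intro continuous_intros cont)
  ultimately show ?thesis
    using der assms closure_subset[of "{x. \<psi> x \<noteq> 0}"] by unfold_locales (auto simp: Cc_infinity_def)
qed

text \<open>The second conclusion comes without data. The bump has radius \<open>1 / 2\<close> about
  \<open>(-5, 0)\<close>, the centre of the box, and is divided by its mass; \<open>C^1\<close> is
  enough for \<open>test_function\<close>.\<close>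

lemma exists_test_function:
  obtains \<psi> D K where "test_function \<psi> D K" "\<And>x. \<psi> x \<ge> 0" "K \<subseteq> Omega_box" "(\<integral>x. \<psi> x \<partial>lborel) = 1"
proof -
  define c :: coord where "c = (-5, 0)"
  let ?\<beta> = "\<lambda>w::coord. bump ((1 / (1 / 2)) *\<^sub>R w)"
  let ?D = "\<lambda>w::coord. (1 / (1 / 2)) *\<^sub>R bump_gradient ((1 / (1 / 2)) *\<^sub>R w)"
  interpret \<beta>: test_function ?\<beta> ?D "cball 0 (1 / 2)" by (rule test_function_bump) simp
  have int: "integrable lborel ?\<beta>" using \<beta>.integrable_times(1)[of "\<lambda>x. 1" 1] by simp
  define \<kappa> where "\<kappa> = (\<integral>x. ?\<beta> x \<partial>lborel)"
  have "(\<integral>x. 9 / 16 * indicator (cball (0::coord) (1 / 4)) x \<partial>lborel) \<le> \<kappa>"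
    unfolding \<kappa>_def
  proof (rule integral_mono)
    show "integrable lborel (\<lambda>x. 9 / 16 * indicator (cball (0::coord) (1 / 4)) x :: real)"
      by (intro integrable_mult_right integrable_indicator_cball)
    show "9 / 16 * indicator (cball 0 (1 / 4)) x \<le> ?\<beta> x" for x
      using bump_ge[of "(1 / (1 / 2)) *\<^sub>R x"] bump_bounds(1)[of "(1 / (1 / 2)) *\<^sub>R x"]
      by (auto simp: indicator_def)
  qed (rule int)
  then have "9 / 16 * measure lborel (cball (0::coord) (1 / 4)) \<le> \<kappa>" by simp
  moreover have "measure lborel (cball (0::coord) (1 / 4)) > 0"
    using content_cball[of "1 / 4" "0::coord"] by simp
  ultimately have \<kappa>: "\<kappa> > 0" by linarith
  have "test_function (\<lambda>x. (1 / \<kappa>) * ?\<beta> (x - c)) (\<lambda>x. (1 / \<kappa>) *\<^sub>R ?D (x - c)) (cball c (1 / 2))"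
  proof
    fix x
    have "((\<lambda>x. ?\<beta> (x - c)) has_derivative (\<lambda>h. h \<bullet> ?D (x - c))) (at x)"
      by (rule has_derivative_compose[OF _ \<beta>.deriv, of "\<lambda>x. x - c"]) (auto intro!: derivative_eq_intros)
    from has_derivative_mult_right[OF this, of "1 / \<kappa>"]
    show "((\<lambda>x. (1 / \<kappa>) * ?\<beta> (x - c)) has_derivative (\<lambda>h. h \<bullet> ((1 / \<kappa>) *\<^sub>R ?D (x - c)))) (at x)"
      by simp
  next
    show "continuous_on UNIV (\<lambda>x. (1 / \<kappa>) *\<^sub>R ?D (x - c))"
      by (intro continuous_on_scaleR continuous_on_const continuous_on_compose2[OF \<beta>.cont] continuous_intros) auto
  next
    show "(1 / \<kappa>) * ?\<beta> (x - c) = 0" if "x \<notin> cball c (1 / 2)" for x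
      using \<beta>.supp[of "x - c"] that by (simp add: dist_norm norm_minus_commute)
  qed simp
  moreover have "(1 / \<kappa>) * ?\<beta> (x - c) \<ge> 0" for x
    using \<kappa> by (intro mult_nonneg_nonneg) (simp_all only: bump_bounds zero_le_divide_1_iff less_imp_le)
  moreover have "cball c (1 / 2) \<subseteq> Omega_box"
  proof
    fix x assume "x \<in> cball c (1 / 2)"
    then have n: "norm (x - c) \<le> 1 / 2" by (simp add: dist_norm norm_minus_commute)
    have fs: "norm (fst (x - c)) \<le> 1 / 2" "norm (snd (x - c)) \<le> 1 / 2"
      using n norm_fst_le[of "fst (x - c)" "snd (x - c)"] norm_snd_le[of "snd (x - c)" "fst (x - c)"]
      unfolding prod.collapse by linarith+
    then have "\<bar>fst x + 5\<bar> \<le> 1 / 2" by (simp add: c_def)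
    then have "-6 < fst x" "fst x < -4" by linarith+
    moreover have "\<bar>snd x $ i\<bar> \<le> 1 / 2" for i
      using component_le_norm_cart[of "snd x" i] fs(2) by (simp add: c_def)
    then have "-1 < snd x $ i \<and> snd x $ i < 1" for i by (smt (verit) field_sum_of_halves)
    ultimately show "x \<in> Omega_box" by (cases x) (simp add: Omega_box_def)
  qed
  moreover have "(\<integral>x. (1 / \<kappa>) * ?\<beta> (x - c) \<partial>lborel) = 1"
  proof -
    have "(\<integral>x. ?\<beta> (x + - c) \<partial>lborel) = \<kappa>"
      unfolding \<kappa>_def by (rule lborel_integral_translate) (rule \<beta>.measurable)
    then show ?thesis using \<kappa> by simp
  qed
  ultimately show ?thesis by (rule that)
qed

section \<open>The step maps and the failure of continuity\<close>

lemma P_box_shift: "x \<in> P_box \<Longrightarrow> \<eta> > 0 \<Longrightarrow> u_pt \<eta> x \<in> H_coord \<and> v_pt \<eta> x \<in> H_coord"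
  by (cases x) (auto simp: P_box_def H_coord_def u_pt_def v_pt_def e_dir_def)

text \<open>The two conditions in \<open>N_nbhd\<close> have separate parts: the first makes the
  step map at \<open>x j\<close> switch on at \<open>y\<close>, the second bounds how far its value
  \<open>u_pt \<eta> (x j)\<close> lies below \<open>y\<close>.\<close>

lemma step_maps_unbounded:
  assumes \<psi>: "\<psi> \<in> Cc_infinity Omega_box" "\<And>p. \<psi> p \<ge> 0" "(LINT p:Omega_box|lborel. \<psi> p) = 1"
    and \<eta>: "\<eta> > 0" "\<eta> * L_grad \<psi> < 1"
    and x: "\<And>j. j \<in> J \<Longrightarrow> x j \<in> P_box" "P_box \<subseteq> (\<Union>j\<in>J. N_nbhd \<eta> (x j))"
    and wb: "way_below (fun_space Disc (E_poset Disc)) \<phi> (Q_map Disc)"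
    and S: "\<And>j. j \<in> J \<Longrightarrow> S_at \<eta> (x j) \<sqsubseteq>\<^bsub>fun_space Disc (E_poset Disc)\<^esub> \<phi>"
  shows False
proof -
  let ?K = "closure {p. \<psi> p \<noteq> 0}"
  interpret test_function \<psi> "gradient \<psi>" ?K
    using \<psi>(1) by (rule test_function_Cc_infinity)
  have K\<Omega>: "?K \<subseteq> Omega_box" using \<psi>(1) by (simp add: Cc_infinity_def)
  have "\<exists>u\<in>H_coord. disk u \<in> fst (\<phi> (disk y)) \<and> u + \<eta> *\<^sub>R e_dir - y \<in> cone"
    if y: "y \<in> Omega_box" for y
  proof -
    have yP: "y \<in> P_box" using y Omega_box_subset_P_box by blast
    then have yH: "y \<in> H_coord" using P_box_subset_H by blast
    obtain j where j: "j \<in> J" "y \<in> N_nbhd \<eta> (x j)" using yP x(2) by blast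
    have uv: "u_pt \<eta> (x j) \<in> H_coord" "v_pt \<eta> (x j) \<in> H_coord" using P_box_shift[OF x(1)[OF j(1)] \<eta>(1)] by blast+
    have "way_below Disc (disk (v_pt \<eta> (x j))) (disk y)"
      using j(2) uv(2) yH by (intro way_below_disk) (auto simp: N_nbhd_def)
    then have "disk (u_pt \<eta> (x j)) \<in> fst (\<phi> (disk y))"
      using S[OF j(1)] disk_in_Disc[OF yH] by (auto simp: S_at_def step_map_def dest!: bspec)
    moreover have "u_pt \<eta> (x j) + \<eta> *\<^sub>R e_dir - y \<in> cone"
    proof -
      have "u_pt \<eta> (x j) - y + \<eta> *\<^sub>R e_dir \<in> cone" using j(2) interior_subset by (auto simp: N_nbhd_def)
      then show ?thesis by (simp add: algebra_simps)
    qed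
    ultimately show ?thesis using uv(1) by blast
  qed
  moreover have "(\<integral>p. \<psi> p \<partial>lborel) = 1" using set_integral_eq_integral(1)[OF K\<Omega>] \<psi>(3) by simp
  ultimately have "1 \<le> \<eta> * (\<integral>p. norm (gradient \<psi> p) \<partial>lborel)"
    by (rule approximant_coarse[OF wb _ test_function_axioms \<psi>(2) K\<Omega>])
  then have "1 \<le> \<eta> * L_grad \<psi>" using set_integral_eq_integral(2)[OF K\<Omega>] by (simp add: L_grad_def)
  then show False using \<eta>(2) by simp
qed

text \<open>The step maps are not shown to be way below \<open>Q_map\<close>. Instead, continuity
  supplies for each \<open>x\<close> a map way below \<open>Q_map\<close> whose value at the disk of
  \<open>v_pt \<eta> x\<close> contains the disk of \<open>u_pt \<eta> x\<close>; compactness and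
  directedness combine finitely many of these into one approximation.\<close>

lemma not_continuous_fun_space: "\<not> continuous_poset (fun_space Disc (E_poset Disc))"
proof
  let ?FS = "fun_space Disc (E_poset Disc)"
  let ?W = "down_wb ?FS (Q_map Disc)"
  assume "continuous_poset ?FS"
  then have dir: "directed ?FS ?W" and lub: "least ?FS (Q_map Disc) (Upper ?FS ?W)"
    using Q_map_in_fun_space by (auto simp: continuous_poset_def)
  obtain \<psi> D K where \<psi>: "test_function \<psi> D K" "\<And>x. \<psi> x \<ge> 0" "K \<subseteq> Omega_box" "(\<integral>x. \<psi> x \<partial>lborel) = 1"
    using exists_test_function by blast
  define L where "L = (\<integral>x. norm (D x) \<partial>lborel)"
  have L: "L \<ge> 0" by (simp add: L_def)
  \<comment> \<open>The added \<open>1\<close> makes \<open>\<eta> * L < 1\<close> and covers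
    \<open>L = 0\<close>.\<close>
  define \<eta> where "\<eta> = 1 / (L + 1)"
  have \<eta>: "\<eta> > 0" "\<eta> * L < 1" using L by (simp_all add: \<eta>_def)
  \<comment> \<open>\<open>N_nbhd\<close> without the restriction to \<open>H_coord\<close>, hence
    open in the whole space and fit for a cover.\<close>
  define N where "N x = {y. y - v_pt \<eta> x \<in> interior cone \<and> u_pt \<eta> x - y + \<eta> *\<^sub>R e_dir \<in> interior cone}" for x
  have oN: "open (N x)" for x
  proof -
    have "N x = (\<lambda>y. y - v_pt \<eta> x) -` interior cone \<inter> (\<lambda>y. u_pt \<eta> x - y + \<eta> *\<^sub>R e_dir) -` interior cone"
      by (auto simp: N_def)
    then show ?thesis by (simp only:) (intro open_Int open_vimage open_interior continuous_intros)
  qed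
  have "x \<in> N x" for x
    using \<eta>(1) by (simp add: N_def u_pt_def v_pt_def e_dir_def interior_cone_iff algebra_simps)
  then have "P_box \<subseteq> (\<Union>x\<in>P_box. N x)" by blast
  then obtain T where T: "T \<subseteq> P_box" "finite T" "P_box \<subseteq> (\<Union>x\<in>T. N x)"
    by (rule compactE_image[OF compact_P_box oN])
  have "\<exists>f\<in>?W. disk (u_pt \<eta> x) \<in> fst (f (disk (v_pt \<eta> x)))" if x: "x \<in> P_box" for x
  proof -
    have uv: "u_pt \<eta> x \<in> H_coord" "v_pt \<eta> x \<in> H_coord" using P_box_shift[OF x \<eta>(1)] by auto
    have "v_pt \<eta> x - u_pt \<eta> x \<in> interior cone"
      using \<eta>(1) by (simp add: u_pt_def v_pt_def e_dir_def interior_cone_iff)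
    then have "disk (u_pt \<eta> x) \<in> fst (Q_map Disc (disk (v_pt \<eta> x)))"
      using uv by (simp add: Q_map_def disk_in_Disc down_wb_def way_below_disk)
    moreover have "snd (Q_map Disc y) = 0" if "y \<in> carrier Disc" for y
      using that by (simp add: Q_map_def)
    ultimately show ?thesis
      using directed_least_fun_space_pointwise[OF dir lub] disk_in_Disc[OF uv(2)] by blast
  qed
  then obtain f where f: "\<And>x. x \<in> P_box \<Longrightarrow> f x \<in> ?W"
    "\<And>x. x \<in> P_box \<Longrightarrow> disk (u_pt \<eta> x) \<in> fst (f x (disk (v_pt \<eta> x)))" by metis
  have fin: "finite (f ` T)" and sub: "f ` T \<subseteq> ?W" using T(1,2) f(1) by auto
  obtain \<phi> where \<phi>: "\<phi> \<in> ?W" and ub: "\<And>h. h \<in> f ` T \<Longrightarrow> h \<sqsubseteq>\<^bsub>?FS\<^esub> \<phi>"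
  proof (rule directed_finite_upper_bound[OF dir _ fin sub])
    show "a \<sqsubseteq>\<^bsub>?FS\<^esub> c" if "a \<sqsubseteq>\<^bsub>?FS\<^esub> b" "b \<sqsubseteq>\<^bsub>?FS\<^esub> c" for a b c
      using that unfolding fun_space_le E_poset_le by (meson order_trans)
  qed (rule that)
  from \<phi> have wb: "way_below ?FS \<phi> (Q_map Disc)" by (simp add: down_wb_def)
  have "1 \<le> \<eta> * L"
    unfolding L_def
  proof (rule approximant_coarse[OF wb _ \<psi>])
    fix y assume "y \<in> Omega_box"
    then have yP: "y \<in> P_box" using Omega_box_subset_P_box by blast
    then have yH: "y \<in> H_coord" using P_box_subset_H by blast
    obtain x where x: "x \<in> T" "y \<in> N x" using T(3) yP by blast
    then have xP: "x \<in> P_box" using T(1) by blast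
    have uv: "u_pt \<eta> x \<in> H_coord" "v_pt \<eta> x \<in> H_coord" using P_box_shift[OF xP \<eta>(1)] by auto
    have v: "disk (v_pt \<eta> x) \<in> carrier Disc" using uv(2) by (rule disk_in_Disc)
    have "disk (u_pt \<eta> x) \<in> fst (\<phi> (disk (v_pt \<eta> x)))"
      using ub[OF imageI[OF x(1)]] f(2)[OF xP] v by auto
    moreover have "fst (\<phi> (disk (v_pt \<eta> x))) \<subseteq> fst (\<phi> (disk y))"
    proof (rule fun_space_fst_mono[OF _ v disk_in_Disc[OF yH]])
      show "\<phi> \<in> carrier ?FS" using wb by (simp add: way_below_def)
      show "disk (v_pt \<eta> x) \<sqsubseteq>\<^bsub>Disc\<^esub> disk y"
        using x(2) interior_subset yH by (auto simp: N_def disk_subset_iff)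
    qed
    moreover have "u_pt \<eta> x + \<eta> *\<^sub>R e_dir - y \<in> cone"
    proof -
      have "u_pt \<eta> x - y + \<eta> *\<^sub>R e_dir \<in> cone" using x(2) interior_subset by (auto simp: N_def)
      then show ?thesis by (simp add: algebra_simps)
    qed
    ultimately show "\<exists>u\<in>H_coord. disk u \<in> fst (\<phi> (disk y)) \<and> u + \<eta> *\<^sub>R e_dir - y \<in> cone"
      using uv(1) by blast
  qed
  then show False using \<eta>(2) by simp
qed

theorem theorem4p4:
  shows "(\<forall>(\<psi> :: coord \<Rightarrow> real) (\<eta> :: real) (m :: nat) (x :: nat \<Rightarrow> coord).
            \<psi> \<in> Cc_infinity Omega_box \<and> (\<forall>p. \<psi> p \<ge> 0) \<and> (LINT p:Omega_box|lborel. \<psi> p) = 1 \<and>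
            \<eta> > 0 \<and> \<eta> * L_grad \<psi> < 1 \<and>
            (\<forall>j\<in>{1..m}. x j \<in> P_box) \<and> P_box \<subseteq> (\<Union>j\<in>{1..m}. N_nbhd \<eta> (x j))
            \<longrightarrow> \<not> (\<exists>\<phi> \<in> {\<phi> \<in> carrier (fun_space Disc (E_poset Disc)).
                             way_below (fun_space Disc (E_poset Disc)) \<phi> (Q_map Disc)}.
                     \<forall>j\<in>{1..m}. S_at \<eta> (x j) \<sqsubseteq>\<^bsub>fun_space Disc (E_poset Disc)\<^esub> \<phi>))
         \<and> \<not> continuous_poset (fun_space Disc (E_poset Disc))"
proof (intro conjI allI impI notI)
  let ?FS = "fun_space Disc (E_poset Disc)"
  fix \<psi> :: "coord \<Rightarrow> real" and \<eta> :: real and m :: nat and x :: "nat \<Rightarrow> coord"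
  assume *: "\<psi> \<in> Cc_infinity Omega_box \<and> (\<forall>p. \<psi> p \<ge> 0) \<and> (LINT p:Omega_box|lborel. \<psi> p) = 1 \<and>
            \<eta> > 0 \<and> \<eta> * L_grad \<psi> < 1 \<and>
            (\<forall>j\<in>{1..m}. x j \<in> P_box) \<and> P_box \<subseteq> (\<Union>j\<in>{1..m}. N_nbhd \<eta> (x j))"
    and "\<exists>\<phi> \<in> {\<phi> \<in> carrier ?FS. way_below ?FS \<phi> (Q_map Disc)}. \<forall>j\<in>{1..m}. S_at \<eta> (x j) \<sqsubseteq>\<^bsub>?FS\<^esub> \<phi>"
  then obtain \<phi> where "way_below ?FS \<phi> (Q_map Disc)"
    "\<And>j. j \<in> {1..m} \<Longrightarrow> S_at \<eta> (x j) \<sqsubseteq>\<^bsub>?FS\<^esub> \<phi>" by blast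
  then show False using * by (intro step_maps_unbounded[of \<psi> \<eta> "{1..m}" x \<phi>]) blast+
qed (use not_continuous_fun_space in blast)

end
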